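(* For every positive integer $n$, $$\sum_{i=0}^{n-1} \sum_{j=0}^{n-1} q^{j^2+i+j} \begin{bmatrix} i+j \\ i \end{bmatrix}_q^2 \equiv \left(\frac{n}{3}\right) q^{\frac{n^2-1}{3}} \pmod{\Phi_n(q)^2}.$$
   Context: The Gaussian $q$-binomial coefficient is $\begin{bmatrix} n \\ k \end{bmatrix}_q=\frac{(q;q)_n}{(q;q)_k(q;q)_{n-k}}$ for $0\le k\le n$ and $0$ otherwise, where $(a;q)_m=(1-a)(1-aq)\cdots(1-aq^{m-1})$ for $m\ge1$ and $(a;q)_0=1$. For an integer $m$, $\left(\frac{m}{3}\right)$ is the Legendre symbol modulo 3: $1$ if $m\equiv1\pmod 3$, $-1$ if $m\equiv 2\pmod 3$, $0$ if $3\mid m$ (so the right-hand side is $0$ when $3\mid n$, and otherwise $(n^2-1)/3$ is an integer). $\Phi_n(q)=\prod_{1\le k\le n,\ \gcd(n,k)=1}(q-e^{2\pi i k/n})$ is the $n$th cyclotomic polynomial, and the congruence is divisibility of the difference by $\Phi_n(q)^2$ in $\mathbb{Z}[q]$. *)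

theory Defs
  imports
    "HOL-Number_Theory.Number_Theory"
    "HOL-Computational_Algebra.Computational_Algebra"
begin

text \<open>All objects live in \<open>\<int>[q]\<close>, represented by the type \<open>int poly\<close>; \<open>qvar\<close> is the indeterminate \<open>q\<close>.\<close>

abbreviation qvar :: "int poly" where
  "qvar \<equiv> [:0, 1:]"

definition q_pochhammer :: "'a::comm_ring_1 \<Rightarrow> 'a \<Rightarrow> nat \<Rightarrow> 'a" where
  "q_pochhammer a q m = (\<Prod>i<m. 1 - a * q ^ i)"

text \<open>Here \<open>div\<close> is exact division in \<open>int poly\<close>; the lemma \<open>gauss_binomial_mult\<close> below shows
  that the denominator always divides the numerator.\<close>

definition gauss_binomial :: "nat \<Rightarrow> nat \<Rightarrow> int poly" where
  "gauss_binomial n k =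
     (if k \<le> n
      then q_pochhammer qvar qvar n div (q_pochhammer qvar qvar k * q_pochhammer qvar qvar (n - k))
      else 0)"

definition complex_cyclotomic :: "nat \<Rightarrow> complex poly" where
  "complex_cyclotomic n =
     (\<Prod>k | 1 \<le> k \<and> k \<le> n \<and> gcd n k = 1. [: - exp (2 * of_real pi * \<i> * of_nat k / of_nat n), 1 :])"

text \<open>The same polynomial as an element of \<open>\<int>[q]\<close>; existence and uniqueness of the integer
  polynomial are the content of the lemma \<open>of_int_cyclotomic\<close> below.\<close>

definition cyclotomic :: "nat \<Rightarrow> int poly" where
  "cyclotomic n = (THE p. map_poly of_int p = complex_cyclotomic n)"


lemma q_pochhammer_dvd:
  assumes "k \<le> n"
  shows "q_pochhammer q q k * q_pochhammer q q (n - k) dvd q_pochhammer q q n"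
  using assms
proof (induction n arbitrary: k)
  case 0
  then show ?case by (simp add: q_pochhammer_def)
next
  case (Suc n)
  let ?P = "q_pochhammer q q"
  have Suc': "?P (Suc m) = ?P m * (1 - q ^ Suc m)" for m
    by (simp add: q_pochhammer_def)
  show ?case
  proof (cases "k = 0 \<or> k = Suc n")
    case True
    then show ?thesis by (auto simp: q_pochhammer_def)
  next
    case False
    then obtain j where j: "k = Suc j" by (cases k) auto
    define l where "l = n - k"
    have n: "n = k + l" "Suc n - k = Suc l" "n - j = Suc l" "n - k = l"
      using Suc.prems False j by (auto simp: l_def)
    obtain a where a: "?P n = ?P k * ?P l * a"
      using Suc.IH[of k] n by (auto simp: dvd_def)
    obtain b where b: "?P n = ?P j * ?P (Suc l) * b"
      using Suc.IH[of j] n j by (auto simp: dvd_def)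
    have pw: "q ^ Suc n = q ^ k * q ^ Suc l"
      by (simp add: n(1) power_add)
    have "?P (Suc n) = ?P n * (1 - q ^ k) + q ^ k * (?P n * (1 - q ^ Suc l))"
      unfolding Suc' pw by (simp add: algebra_simps)
    also have "?P n * (1 - q ^ k) = ?P k * ?P (Suc l) * b"
      by (subst b) (simp add: j Suc'[of j] algebra_simps)
    also have "?P n * (1 - q ^ Suc l) = ?P k * ?P (Suc l) * a"
      by (subst a) (simp add: Suc'[of l] algebra_simps)
    finally have "?P (Suc n) = ?P k * ?P (Suc l) * (b + q ^ k * a)"
      by (simp add: algebra_simps)
    then show ?thesis unfolding n(2) by (rule dvdI)
  qed
qed

lemma gauss_binomial_mult:
  assumes "k \<le> n"
  shows "gauss_binomial n k * (q_pochhammer qvar qvar k * q_pochhammer qvar qvar (n - k))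
           = q_pochhammer qvar qvar n"
  using assms q_pochhammer_dvd[OF assms, of qvar] by (simp add: gauss_binomial_def)

lemma q_pochhammer_qvar_nonzero: "q_pochhammer qvar qvar n \<noteq> 0"
proof -
  have "poly (1 - qvar * qvar ^ i) 0 = 1" for i
    by simp
  then have "1 - qvar * qvar ^ i \<noteq> 0" for i
    by (metis poly_0 zero_neq_one)
  then show ?thesis by (simp add: q_pochhammer_def)
qed


lemma of_int_poly_mult:
  "map_poly of_int (p * q) = (map_poly of_int p * map_poly of_int q :: complex poly)"
  by (rule poly_eqI) (simp add: coeff_map_poly coeff_mult)

lemma of_int_poly_add:
  "map_poly of_int (p + q) = (map_poly of_int p + map_poly of_int q :: complex poly)"
  by (rule poly_eqI) (simp add: coeff_map_poly)

lemma of_int_poly_inj: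
  assumes "map_poly of_int p = (map_poly of_int q :: complex poly)"
  shows "p = q"
proof (rule poly_eqI)
  fix i
  have "coeff (map_poly of_int p :: complex poly) i = coeff (map_poly of_int q) i"
    by (simp add: assms)
  then show "coeff p i = coeff q i" by (simp add: coeff_map_poly)
qed

lemma of_int_poly_monic_quotient:
  fixes A B :: "int poly" and F :: "complex poly"
  assumes "lead_coeff A = 1" and eq: "map_poly of_int A * F = map_poly of_int B"
  shows "\<exists>Q. map_poly of_int Q = F"
proof -
  have A0: "A \<noteq> 0" using assms(1) by auto
  obtain Q R where QR: "pseudo_divmod B A = (Q, R)" by force
  from pseudo_divmod[OF A0 QR] assms(1)
  have B: "B = A * Q + R" and R: "R = 0 \<or> degree R < degree A" by auto
  let ?h = "map_poly of_int :: int poly \<Rightarrow> complex poly"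
  have deg: "degree (?h p) = degree p" for p by (simp add: degree_map_poly)
  have *: "?h A * (F - ?h Q) = ?h R"
    using eq unfolding B by (simp add: of_int_poly_mult of_int_poly_add algebra_simps)
  have "?h A \<noteq> 0" using A0 by (metis map_poly_0 of_int_poly_inj)
  have "F - ?h Q = 0"
  proof (rule ccontr)
    assume nz: "F - ?h Q \<noteq> 0"
    then have "degree (?h A * (F - ?h Q)) \<ge> degree A"
      using \<open>?h A \<noteq> 0\<close> by (simp add: degree_mult_eq deg)
    moreover have "?h R \<noteq> 0" using nz \<open>?h A \<noteq> 0\<close> * by (metis mult_eq_0_iff)
    ultimately show False using R * deg[of R] by auto
  qed
  then show ?thesis by (intro exI[of _ Q]) simp
qed

lemma complex_cyclotomic_monic: "lead_coeff (complex_cyclotomic n) = 1"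
  by (simp add: complex_cyclotomic_def lead_coeff_prod)

lemma prod_roots_of_unity:
  assumes "n > 0"
  shows "(\<Prod>k\<in>{1..n}. [: - exp (2 * of_real pi * \<i> * of_nat k / of_nat n), 1 :])
           = ([:0, 1:] ^ n - 1 :: complex poly)"
proof -
  define w where "w = (\<lambda>k. exp (2 * of_real pi * \<i> * of_nat k / of_nat n) :: complex)"
  have w_cis: "w k = cis (2 * pi * real k / real n)" for k
    by (simp add: w_def cis_conv_exp mult_ac)
  have wn: "w n = w 0" using assms by (simp add: w_cis)
  have bij: "bij_betw w {..<n} {z. z ^ n = 1}"
    using bij_betw_roots_unity[OF assms] by (simp add: w_cis[abs_def])
  let ?p = "[:0, 1:] ^ n - 1 :: complex poly"
  have p_monom: "?p = Polynomial.monom 1 n - 1"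
    by (simp add: monom_altdef)
  have deg: "degree ?p = n"
    unfolding diff_conv_add_uminus
    by (subst degree_add_eq_left) (auto simp: degree_linear_power assms)
  have lc: "lead_coeff ?p = 1"
    unfolding deg using assms by (simp add: p_monom)
  have roots: "poly ?p z = 0 \<longleftrightarrow> z ^ n = 1" for z
    by (simp add: poly_power)
  have "rsquarefree ?p"
    unfolding rsquarefree_roots
  proof (intro allI notI)
    fix a assume a: "poly ?p a = 0 \<and> poly (pderiv ?p) a = 0"
    have "pderiv ?p = Polynomial.monom (of_nat n) (n - 1)"
      unfolding p_monom by (simp add: pderiv_diff pderiv_monom)
    with a assms have "a = 0" by (simp add: poly_monom)
    with a assms have "(0::complex) ^ n = 1" by (simp add: poly_power)
    then show False using assms by (metis zero_power zero_neq_one)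
  qed
  then have "?p = (\<Prod>z | z ^ n = 1. [:-z, 1:])"
    using complex_poly_decompose_rsquarefree[of ?p] lc by (simp add: roots)
  also have "\<dots> = (\<Prod>k<n. [:- w k, 1:])"
    using prod.reindex_bij_betw[OF bij, of "\<lambda>z. [:-z, 1:]"] by simp
  also have "\<dots> = (\<Prod>k\<in>{1..n}. [:- w k, 1:])"
  proof -
    obtain m where m: "n = Suc m" using assms by (cases n) auto
    have "(\<Prod>k<n. [:- w k, 1:]) = [:- w n, 1:] * (\<Prod>k<m. [:- w (Suc k), 1:])"
      unfolding wn unfolding m by (subst prod.lessThan_Suc_shift) simp
    also have "\<dots> = (\<Prod>k<n. [:- w (Suc k), 1:])"
      unfolding m prod.lessThan_Suc by (simp only: mult.commute)
    also have "\<dots> = (\<Prod>k\<in>{1..n}. [:- w k, 1:])"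
      by (simp only: One_nat_def prod.atLeast1_atMost_eq)
    finally show ?thesis .
  qed
  finally show ?thesis by (simp add: w_def)
qed

lemma prod_complex_cyclotomic:
  assumes "n > 0"
  shows "(\<Prod>d | d dvd n. complex_cyclotomic d) = [:0, 1:] ^ n - 1"
proof -
  define f where "f = (\<lambda>k m. [: - exp (2 * of_real pi * \<i> * of_nat k / of_nat m), 1 :] :: complex poly)"
  have part: "(\<Prod>k | k \<in> {1..n} \<and> n div gcd n k = d. f k n) = complex_cyclotomic d"
    if "d dvd n" for d
  proof -
    obtain c where "n = d * c" using \<open>d dvd n\<close> by (rule dvdE)
    then have c: "n = c * d" by (simp only: mult.commute)
    have pos: "c > 0" "d > 0" using assms c by auto
    have "complex_cyclotomic d = (\<Prod>j | 1 \<le> j \<and> j \<le> d \<and> gcd d j = 1. f j d)"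
      by (simp add: complex_cyclotomic_def f_def)
    also have "\<dots> = (\<Prod>k | k \<in> {1..n} \<and> n div gcd n k = d. f k n)"
    proof (rule prod.reindex_bij_witness[of _ "\<lambda>k. k div c" "\<lambda>j. c * j"])
      fix k assume k: "k \<in> {k. k \<in> {1..n} \<and> n div gcd n k = d}"
      have "n = gcd n k * d"
        using k dvd_mult_div_cancel[of "gcd n k" n] by simp
      then have g: "gcd n k = c" using c pos by simp
      then have "c dvd k" using gcd_dvd2[of n k] by simp
      then obtain j where j: "k = c * j" by (rule dvdE)
      show "c * (k div c) = k" using pos by (simp add: j)
      have "c * gcd d j = c" using g unfolding c j by (simp add: gcd_mult_distrib_nat)
      then have "gcd d j = 1" using pos by simp
      then show "k div c \<in> {j. 1 \<le> j \<and> j \<le> d \<and> gcd d j = 1}"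
        using k pos by (auto simp: j c)
    next
      fix j assume j: "j \<in> {j. 1 \<le> j \<and> j \<le> d \<and> gcd d j = 1}"
      show "c * j div c = j" using pos by simp
      have "gcd n (c * j) = c"
        using j unfolding c by (simp flip: gcd_mult_distrib_nat)
      then show "c * j \<in> {k. k \<in> {1..n} \<and> n div gcd n k = d}"
        using j pos by (auto simp: c)
      show "f (c * j) n = f j d"
        using pos by (simp add: f_def c field_simps)
    qed
    finally show ?thesis by simp
  qed
  have "(\<Prod>d | d dvd n. complex_cyclotomic d)
          = (\<Prod>d | d dvd n. \<Prod>k | k \<in> {1..n} \<and> n div gcd n k = d. f k n)"
    by (rule prod.cong) (simp_all only: mem_Collect_eq part)
  also have "\<dots> = (\<Prod>k\<in>{1..n}. f k n)"
  proof (rule prod.group)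
    show "(\<lambda>k. n div gcd n k) ` {1..n} \<subseteq> {d. d dvd n}"
    proof clarify
      fix k
      have "n = (n div gcd n k) * gcd n k" by simp
      then show "n div gcd n k dvd n" by (rule dvdI)
    qed
  qed (use assms in auto)
  finally show ?thesis
    using prod_roots_of_unity[OF assms] by (simp add: f_def)
qed

lemma complex_cyclotomic_integral: "\<exists>p. map_poly of_int p = complex_cyclotomic n"
proof (induction n rule: less_induct)
  case (less n)
  show ?case
  proof (cases "n = 0")
    case True
    have "complex_cyclotomic 0 = 1"
    proof -
      have "{k::nat. 1 \<le> k \<and> k \<le> 0 \<and> gcd 0 k = 1} = {}" by auto
      then show ?thesis unfolding complex_cyclotomic_def by (simp only: prod.empty)
    qed
    then show ?thesis using True by (intro exI[of _ 1]) simp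
  next
    case False
    let ?h = "map_poly of_int :: int poly \<Rightarrow> complex poly"
    let ?D = "{d. d dvd n \<and> d \<noteq> n}"
    have fin: "finite ?D" using False by simp
    have "\<forall>d\<in>?D. \<exists>p. ?h p = complex_cyclotomic d"
      using less.IH False by (auto dest: dvd_imp_le)
    then obtain P where P: "\<And>d. d \<in> ?D \<Longrightarrow> ?h (P d) = complex_cyclotomic d"
      by metis
    define A where "A = prod P ?D"
    have hprod: "?h (prod P S) = (\<Prod>d\<in>S. ?h (P d))" if "finite S" for S
      using that by (induction S) (simp_all add: of_int_poly_mult)
    have hA: "?h A = prod complex_cyclotomic ?D"
      unfolding A_def hprod[OF fin] by (intro prod.cong) (auto simp: P)
    have "lead_coeff (?h A) = 1"
      unfolding hA by (simp add: lead_coeff_prod complex_cyclotomic_monic)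
    then have monic: "lead_coeff A = 1"
      by (simp add: degree_map_poly coeff_map_poly)
    have set: "{d. d dvd n} = insert n ?D" by auto
    have "?h A * complex_cyclotomic n = (\<Prod>d | d dvd n. complex_cyclotomic d)"
      unfolding hA set using fin by (subst prod.insert) (auto simp: mult.commute)
    also have "\<dots> = [:0, 1:] ^ n - 1"
      using False by (intro prod_complex_cyclotomic) simp
    also have "([:0, 1:] ^ n :: complex poly) = Polynomial.monom 1 n"
      by (simp add: monom_altdef)
    also have "Polynomial.monom 1 n - 1 = ?h (Polynomial.monom 1 n - 1)"
      by (rule poly_eqI) (simp add: coeff_map_poly)
    finally show ?thesis by (rule of_int_poly_monic_quotient[OF monic])
  qed
qed

lemma of_int_cyclotomic: "map_poly of_int (cyclotomic n) = complex_cyclotomic n"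
proof -
  obtain p where "map_poly of_int p = complex_cyclotomic n"
    using complex_cyclotomic_integral by blast
  then show ?thesis
    unfolding cyclotomic_def by (rule theI) (metis \<open>map_poly of_int p = _\<close> of_int_poly_inj)
qed

lemma Legendre_3:
  "Legendre m 3 = (if m mod 3 = 1 then 1 else if m mod 3 = 2 then - 1 else 0)"
proof -
  have 0: "[m = 0] (mod 3) \<longleftrightarrow> m mod 3 = 0" by (simp add: cong_def)
  have sq: "y\<^sup>2 mod 3 = 0 \<or> y\<^sup>2 mod 3 = 1" for y :: int
  proof -
    have "y mod 3 = 0 \<or> y mod 3 = 1 \<or> y mod 3 = 2" by presburger
    moreover have "y\<^sup>2 mod 3 = (y mod 3)\<^sup>2 mod 3" by (simp add: power_mod)
    ultimately show ?thesis by auto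
  qed
  have "QuadRes 3 m" if "m mod 3 = 1"
    unfolding QuadRes_def cong_def using that by (intro exI[of _ 1]) simp
  moreover have "\<not> QuadRes 3 m" if "m mod 3 = 2"
    unfolding QuadRes_def cong_def using that sq by (metis zero_neq_numeral one_eq_numeral_iff semiring_norm(83))
  moreover have "m mod 3 = 0 \<or> m mod 3 = 1 \<or> m mod 3 = 2" by presburger
  ultimately show ?thesis unfolding Legendre_def 0 by auto
qed

end

theory Submission
  imports Defs "HOL-Library.Nat_Bijection"
begin

text \<open>Terms with \<open>i + j \<ge> n\<close> vanish modulo \<open>\<Phi>\<^sub>n\<^sup>2\<close>, and on \<open>i + j = k < n\<close> the \<open>q\<close>-Vandermonde identity
  collapses the sum to \<open>q\<^sup>k [2k, k]\<close>. An identity of Tauraso rewrites the resulting sum over \<open>k < n\<close> as a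
  signed sum of the \<open>[2n, n + m]\<close> over \<open>m > 0\<close> prime to 3. At a primitive \<open>n\<close>th root of unity \<open>z\<close> only
  \<open>m = n\<close> contributes to the value, while \<open>m < n\<close> contributes to the derivative a multiple of
  \<open>1 / (1 - z\<^sup>m)\<close>. After the substitution \<open>p = z\<^sup>3\<close> these contributions form the sum
  \<open>\<Sum>\<^sub>v (- 1)\<^sup>v p\<^bsup>v(v+1)/2 - jv\<^esup> / (1 - p\<^sup>v)\<close> over \<open>1 \<le> v \<le> 2j\<close>, which equals
  \<open>- \<Sum>\<^sub>i 1 / (1 - p\<^sup>i)\<close> over \<open>j < i \<le> 2j\<close> for generic \<open>p\<close> (if \<open>3\<close> divides \<open>n\<close>, they cancel in pairs
  instead). Pairing \<open>i\<close> with \<open>n - i\<close> evaluates the right-hand side at a root of unity, so both the value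
  and the derivative of the difference vanish at \<open>z\<close>.\<close>

section \<open>Gaussian binomial coefficients\<close>

lemma q_pochhammer_Suc: "q_pochhammer q q (Suc m) = q_pochhammer q q m * (1 - q ^ Suc m)"
  by (simp add: q_pochhammer_def)

lemma gauss_binomial_eq_0: "n < k \<Longrightarrow> gauss_binomial n k = 0"
  by (simp add: gauss_binomial_def)

text \<open>Cancelling the nonzero Pochhammer product in the integral domain Z[q] lets later
  identities be checked in product form, without handling \<open>div\<close>.\<close>

lemma gauss_binomial_unique:
  assumes "k \<le> n"
    and "x * (q_pochhammer qvar qvar k * q_pochhammer qvar qvar (n - k)) = q_pochhammer qvar qvar n"
  shows "gauss_binomial n k = x"
  using gauss_binomial_mult[OF assms(1)] assms(2) q_pochhammer_qvar_nonzero
  by (metis mult_cancel_right mult_eq_0_iff)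

lemma gauss_binomial_0 [simp]: "gauss_binomial n 0 = 1"
  by (rule gauss_binomial_unique) (simp_all add: q_pochhammer_def)

lemma gauss_binomial_self [simp]: "gauss_binomial n n = 1"
  by (rule gauss_binomial_unique) (simp_all add: q_pochhammer_def)

lemma gauss_binomial_symmetric:
  assumes "k \<le> n"
  shows "gauss_binomial n (n - k) = gauss_binomial n k"
  using gauss_binomial_mult[OF assms] assms
  by (intro gauss_binomial_unique) (simp_all add: mult.commute)

text \<open>Over the common denominator this q-Pascal rule is
  \<open>1 - q^(a + b) = (1 - q^a) + q^a * (1 - q^b)\<close> with \<open>a = k + 1\<close> and
  \<open>a + b = n + 1\<close>.\<close>

lemma gauss_binomial_Suc_Suc:
  "gauss_binomial (Suc n) (Suc k) = gauss_binomial n k + qvar ^ Suc k * gauss_binomial n (Suc k)"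
proof (cases "k < n")
  case False
  then show ?thesis
    by (cases "k = n") (simp_all add: gauss_binomial_eq_0)
next
  case True
  then obtain l where n: "n = Suc (k + l)"
    using less_imp_Suc_add by blast
  let ?P = "q_pochhammer qvar qvar" and ?b = gauss_binomial
  have a: "?b n k * (?P k * ?P (Suc l)) = ?P n"
    using gauss_binomial_mult[of k n] by (simp add: n)
  have b: "?b n (Suc k) * (?P (Suc k) * ?P l) = ?P n"
    using gauss_binomial_mult[of "Suc k" n] by (simp add: n)
  have "(?b n k + qvar ^ Suc k * ?b n (Suc k)) * (?P (Suc k) * ?P (Suc l))
      = (?b n k * (?P k * ?P (Suc l))) * (1 - qvar ^ Suc k)
        + qvar ^ Suc k * (1 - qvar ^ Suc l) * (?b n (Suc k) * (?P (Suc k) * ?P l))"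
    by (simp only: q_pochhammer_Suc ring_distribs mult_ac)
  also have "\<dots> = ?P n * (1 - qvar ^ (Suc k + Suc l))"
    unfolding a b power_add by (simp only: algebra_simps)
  also have "\<dots> = ?P (Suc n)"
    by (simp only: q_pochhammer_Suc n add_Suc_right add_Suc)
  finally show ?thesis
    by (intro gauss_binomial_unique) (simp_all add: n)
qed

text \<open>The symmetry of the coefficients turns the first q-Pascal rule into this second
  one.\<close>

lemma gauss_binomial_Suc_Suc':
  "gauss_binomial (Suc n) (Suc k) = qvar ^ (n - k) * gauss_binomial n k + gauss_binomial n (Suc k)"
proof (cases "k < n")
  case False
  then show ?thesis
    by (cases "k = n") (simp_all add: gauss_binomial_eq_0)
next
  case True
  then obtain l where n: "n = Suc (k + l)"
    using less_imp_Suc_add by blast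
  have "gauss_binomial (Suc n) (Suc k) = gauss_binomial (Suc n) (Suc l)"
    using gauss_binomial_symmetric[of "Suc k" "Suc n"] by (simp add: n)
  also have "\<dots> = gauss_binomial n l + qvar ^ Suc l * gauss_binomial n (Suc l)"
    by (rule gauss_binomial_Suc_Suc)
  also have "gauss_binomial n l = gauss_binomial n (Suc k)"
    using gauss_binomial_symmetric[of "Suc k" n] by (simp add: n)
  also have "gauss_binomial n (Suc l) = gauss_binomial n k"
    using gauss_binomial_symmetric[of k n] by (simp add: n)
  finally show ?thesis
    by (simp add: n)
qed

text \<open>The two q-Pascal rules have the same left-hand side, so their right-hand sides
  agree.\<close>

lemma gauss_binomial_ratio:
  "(1 - qvar ^ (n - k)) * gauss_binomial n k = (1 - qvar ^ Suc k) * gauss_binomial n (Suc k)"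
  using gauss_binomial_Suc_Suc[of n k] gauss_binomial_Suc_Suc'[of n k]
  by (simp add: left_diff_distrib)

text \<open>The offset \<open>d\<close> lets the induction on \<open>a\<close> close: q-Pascal
  splits the sum into one with the same \<open>d\<close> and, after shifting \<open>j\<close>, one
  with \<open>d + 1\<close>; q-Pascal then recombines the two values.\<close>

lemma q_Vandermonde:
  "(\<Sum>j\<le>a. qvar ^ (j * (j + d)) * gauss_binomial a j * gauss_binomial b (j + d))
     = gauss_binomial (a + b) (a + d)"
proof (induction a arbitrary: d)
  case 0
  then show ?case by simp
next
  case (Suc a)
  let ?f = "\<lambda>j. qvar ^ (j * (j + d)) * gauss_binomial b (j + d)"
  let ?g = "\<lambda>j. qvar ^ (j * (j + Suc d)) * gauss_binomial a j * gauss_binomial b (j + Suc d)"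
  have shift: "?f (Suc j) * (qvar ^ (a - j) * gauss_binomial a j) = qvar ^ Suc (a + d) * ?g j"
    if "j \<le> a" for j
  proof -
    have "Suc j * (Suc j + d) + (a - j) = Suc (a + d) + j * (j + Suc d)"
      using that by (simp add: algebra_simps)
    then have "qvar ^ (Suc j * (Suc j + d)) * qvar ^ (a - j)
        = qvar ^ Suc (a + d) * qvar ^ (j * (j + Suc d))"
      by (simp only: power_add[symmetric])
    then show ?thesis
      by (simp only: mult_ac add_Suc add_Suc_right)
  qed
  have "(\<Sum>j\<le>Suc a. qvar ^ (j * (j + d)) * gauss_binomial (Suc a) j * gauss_binomial b (j + d))
      = ?f 0 + (\<Sum>j\<le>a. ?f (Suc j) * gauss_binomial (Suc a) (Suc j))"
    by (subst sum.atMost_Suc_shift) (simp only: gauss_binomial_0 mult_ac mult_1_left)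
  also have "\<dots> = ?f 0 + (\<Sum>j\<le>a. ?f (Suc j) * gauss_binomial a (Suc j))
      + (\<Sum>j\<le>a. ?f (Suc j) * (qvar ^ (a - j) * gauss_binomial a j))"
    by (simp only: gauss_binomial_Suc_Suc' distrib_left sum.distrib add_ac)
  also have "?f 0 + (\<Sum>j\<le>a. ?f (Suc j) * gauss_binomial a (Suc j))
      = (\<Sum>j\<le>Suc a. ?f j * gauss_binomial a j)"
    by (subst sum.atMost_Suc_shift) simp
  also have "\<dots> = (\<Sum>j\<le>a. ?f j * gauss_binomial a j)"
    by (simp add: gauss_binomial_eq_0)
  also have "\<dots> = gauss_binomial (a + b) (a + d)"
    by (simp only: Suc.IH[of d, symmetric] mult_ac)
  also have "(\<Sum>j\<le>a. ?f (Suc j) * (qvar ^ (a - j) * gauss_binomial a j))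
      = (\<Sum>j\<le>a. qvar ^ Suc (a + d) * ?g j)"
    by (intro sum.cong refl shift) simp
  also have "\<dots> = qvar ^ Suc (a + d) * gauss_binomial (a + b) (a + Suc d)"
    by (simp only: sum_distrib_left[symmetric] Suc.IH)
  finally show ?case
    by (simp add: gauss_binomial_Suc_Suc)
qed

lemma q_Vandermonde_central:
  "(\<Sum>j\<le>m. qvar ^ j\<^sup>2 * (gauss_binomial m j)\<^sup>2) = gauss_binomial (2 * m) m"
  using q_Vandermonde[where a = m and b = m and d = 0]
  by (simp add: power2_eq_square mult_2 mult.assoc)

section \<open>Tauraso's identity for sums of central coefficients\<close>

text \<open>One use of the first q-Pascal rule followed by two of the second expresses a coefficient
  of row \<open>2 * n + 2\<close> by three neighbours in row \<open>2 * n\<close>.\<close>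

lemma gauss_binomial_central_step:
  "gauss_binomial (2 * Suc n) (Suc n + Suc m)
     = qvar ^ (n + m + 2) * gauss_binomial (2 * n) (n + m + 2)
       + (1 + qvar ^ (2 * n + 1)) * gauss_binomial (2 * n) (n + m + 1)
       + qvar ^ (n - m) * gauss_binomial (2 * n) (n + m)"
proof (cases "m \<le> n")
  case False
  then show ?thesis by (simp add: gauss_binomial_eq_0)
next
  case True
  let ?b = "gauss_binomial"
  have "?b (Suc (Suc (2 * n))) (Suc (Suc (n + m)))
      = ?b (Suc (2 * n)) (Suc (n + m)) + qvar ^ (n + m + 2) * ?b (Suc (2 * n)) (Suc (Suc (n + m)))"
    by (subst gauss_binomial_Suc_Suc) simp
  also have "?b (Suc (2 * n)) (Suc (n + m)) = qvar ^ (n - m) * ?b (2 * n) (n + m) + ?b (2 * n) (n + m + 1)"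
    by (subst gauss_binomial_Suc_Suc') simp
  also have "?b (Suc (2 * n)) (Suc (Suc (n + m)))
      = qvar ^ (n - Suc m) * ?b (2 * n) (n + m + 1) + ?b (2 * n) (n + m + 2)"
    by (subst gauss_binomial_Suc_Suc') simp
  also have "qvar ^ (n + m + 2) * (qvar ^ (n - Suc m) * ?b (2 * n) (n + m + 1) + ?b (2 * n) (n + m + 2))
      = qvar ^ (2 * n + 1) * ?b (2 * n) (n + m + 1) + qvar ^ (n + m + 2) * ?b (2 * n) (n + m + 2)"
  \<comment> \<open>For \<open>m = n\<close> the exponent \<open>n - Suc m\<close> truncates and the
    powers do not combine, but then the coefficient is 0.\<close>
  proof (cases "m = n")
    case True
    then show ?thesis by (simp add: gauss_binomial_eq_0)
  next
    case False
    with True have "n + m + 2 + (n - Suc m) = 2 * n + 1" by simp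
    then have "qvar ^ (n + m + 2) * qvar ^ (n - Suc m) = qvar ^ (2 * n + 1)"
      by (simp only: power_add[symmetric])
    then show ?thesis
      by (simp only: distrib_left mult.assoc[symmetric])
  qed
  finally show ?thesis
    by (simp add: algebra_simps)
qed

text \<open>The two indices \<open>3r + 1\<close> and \<open>3r + 2\<close> are grouped because only their sum telescopes in \<open>r\<close>
  when \<open>n\<close> is increased.\<close>

definition tauraso_term :: "nat \<Rightarrow> nat \<Rightarrow> int poly" where
  "tauraso_term n r =
     qvar ^ (6 * r\<^sup>2 + 3 * r) * gauss_binomial (2 * n) (n + (3 * r + 1))
     - qvar ^ (6 * r\<^sup>2 + 9 * r + 3) * gauss_binomial (2 * n) (n + (3 * r + 2))"

text \<open>After the three-term step the coefficients at offsets \<open>3 * r + 1\<close> and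
  \<open>3 * r + 2\<close> cancel by the ratio relation. The offsets \<open>3 * r\<close> and
  \<open>3 * Suc r\<close> remain, with weights of the same shape, so the sum over \<open>r\<close>
  telescopes.\<close>

lemma tauraso_term_Suc:
  "tauraso_term (Suc n) r - tauraso_term n r =
     qvar ^ (6 * r\<^sup>2 + n) * gauss_binomial (2 * n) (n + 3 * r)
     - qvar ^ (6 * (Suc r)\<^sup>2 + n) * gauss_binomial (2 * n) (n + 3 * Suc r)"
proof -
  let ?b = "\<lambda>m. gauss_binomial (2 * n) (n + m)" and ?e = "6 * r\<^sup>2 + 3 * r"
  let ?q = "\<lambda>k. qvar ^ k"
  have 1: "gauss_binomial (2 * Suc n) (Suc n + (3 * r + 1))
     = ?q (n + 3 * r + 2) * ?b (3 * r + 2) + (1 + ?q (2 * n + 1)) * ?b (3 * r + 1)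
       + ?q (n - 3 * r) * ?b (3 * r)"
    using gauss_binomial_central_step[of n "3 * r"] by (simp add: add_ac)
  have 2: "gauss_binomial (2 * Suc n) (Suc n + (3 * r + 2))
     = ?q (n + 3 * r + 3) * ?b (3 * r + 3) + (1 + ?q (2 * n + 1)) * ?b (3 * r + 2)
       + ?q (n - Suc (3 * r)) * ?b (3 * r + 1)"
    using gauss_binomial_central_step[of n "3 * r + 1"] by (simp add: add_ac eval_nat_numeral)
  have ratio: "(1 - ?q (n - Suc (3 * r))) * ?b (3 * r + 1) = (1 - ?q (n + 3 * r + 2)) * ?b (3 * r + 2)"
    using gauss_binomial_ratio[of "2 * n" "n + (3 * r + 1)"] by (simp add: add_ac)
  have e: "6 * r\<^sup>2 + 9 * r + 3 = ?e + (6 * r + 3)" "6 * (Suc r)\<^sup>2 + n = ?e + (6 * r + 3) + (n + 3 * r + 3)"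
    by (simp_all add: power2_eq_square algebra_simps)
  have zero: "?q ?e * ?q (n - 3 * r) * ?b (3 * r) = ?q (6 * r\<^sup>2 + n) * ?b (3 * r)"
  proof (cases "3 * r \<le> n")
    case True
    then have "?e + (n - 3 * r) = 6 * r\<^sup>2 + n" by simp
    then show ?thesis by (metis power_add)
  qed (simp add: gauss_binomial_eq_0)
  have low: "?q (6 * r + 3) * ?q (n - Suc (3 * r)) * ?b (3 * r + 1) = ?q (n + 3 * r + 2) * ?b (3 * r + 1)"
  proof (cases "Suc (3 * r) \<le> n")
    case True
    then have "(6 * r + 3) + (n - Suc (3 * r)) = n + 3 * r + 2" by simp
    then show ?thesis by (metis power_add)
  qed (simp add: gauss_binomial_eq_0)
  have mid: "?q (2 * n + 1) * ?b (3 * r + 1) + ?q (n + 3 * r + 2) * ?b (3 * r + 2)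
     - ?q (6 * r + 3) * ?q (2 * n + 1) * ?b (3 * r + 2) - ?q (n + 3 * r + 2) * ?b (3 * r + 1) = 0"
  proof (cases "Suc (3 * r) \<le> n")
    case True
    then have s: "n + 3 * r + 2 + (n - Suc (3 * r)) = 2 * n + 1"
      "n + 3 * r + 2 + (n + 3 * r + 2) = 6 * r + 3 + (2 * n + 1)" by simp_all
    \<comment> \<open>Here \<open>X\<close>, \<open>Y\<close>, \<open>Q\<close>, \<open>W\<close>
      stand for the powers of q with exponents \<open>n + 3 * r + 2\<close>,
      \<open>n - Suc (3 * r)\<close>, \<open>6 * r + 3\<close>, \<open>2 * n + 1\<close>; the claim
      is the ratio relation multiplied by \<open>X\<close>.\<close>
    have alg: "W * b + X * c - Q * W * c - X * b = 0"
      if "X * Y = W" "X * X = Q * W" "(1 - Y) * b = (1 - X) * c" for b c Q W X Y :: "int poly"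
    proof -
      have "X * ((1 - Y) * b) = X * ((1 - X) * c)"
        by (simp only: that(3))
      then show ?thesis
        unfolding that(2)[symmetric] unfolding that(1)[symmetric] by (simp add: algebra_simps)
    qed
    show ?thesis
      by (rule alg[OF _ _ ratio]) (simp_all only: s power_add[symmetric])
  qed (simp add: gauss_binomial_eq_0)
  have "tauraso_term (Suc n) r - tauraso_term n r
    = ?q ?e * ?q (n - 3 * r) * ?b (3 * r)
      + ?q ?e * (?q (2 * n + 1) * ?b (3 * r + 1) + ?q (n + 3 * r + 2) * ?b (3 * r + 2)
        - ?q (6 * r + 3) * ?q (2 * n + 1) * ?b (3 * r + 2)
        - ?q (6 * r + 3) * ?q (n - Suc (3 * r)) * ?b (3 * r + 1))
      - ?q ?e * ?q (6 * r + 3) * ?q (n + 3 * r + 3) * ?b (3 * r + 3)"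
    unfolding tauraso_term_def 1 2 e(1) power_add[of _ ?e "6 * r + 3"]
    by (simp only: algebra_simps mult_1_left mult_1_right)
  also have "\<dots> = ?q (6 * r\<^sup>2 + n) * ?b (3 * r) - ?q ?e * ?q (6 * r + 3) * ?q (n + 3 * r + 3) * ?b (3 * r + 3)"
    unfolding zero low mid by simp
  also have "?q ?e * ?q (6 * r + 3) * ?q (n + 3 * r + 3) = ?q (6 * (Suc r)\<^sup>2 + n)"
    unfolding e(2) by (simp only: power_add)
  finally show ?thesis
    by (simp add: add_ac)
qed

text \<open>Passing from \<open>n\<close> to \<open>n + 1\<close> changes the right side by a
  telescoping sum: its start is the new summand on the left, and its end vanishes because
  \<open>n < 3 * R\<close>. Keeping \<open>R\<close> fixed gives both sums the same range.\<close>

lemma sum_central_gauss_binomial: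
  assumes "n \<le> 3 * R"
  shows "(\<Sum>k<n. qvar ^ k * gauss_binomial (2 * k) k) = (\<Sum>r<R. tauraso_term n r)"
  using assms
proof (induction n)
  case 0
  then show ?case by (simp add: tauraso_term_def gauss_binomial_eq_0)
next
  case (Suc n)
  let ?t = "\<lambda>r. qvar ^ (6 * r\<^sup>2 + n) * gauss_binomial (2 * n) (n + 3 * r)"
  have "(\<Sum>r<R. tauraso_term (Suc n) r) - (\<Sum>r<R. tauraso_term n r) = (\<Sum>r<R. ?t r - ?t (Suc r))"
    unfolding sum_subtractf[symmetric] by (intro sum.cong refl tauraso_term_Suc)
  also have "\<dots> = ?t 0 - ?t R"
    by (rule sum_lessThan_telescope')
  also have "?t R = 0"
    using Suc.prems by (simp add: gauss_binomial_eq_0)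
  finally show ?case
    using Suc by (simp add: algebra_simps)
qed

section \<open>A finite Lambert-type sum\<close>

lemma double_triangle: "2 * triangle v = v * Suc v"
  by (induction v) simp_all

text \<open>With \<open>z\<close> the inverse of \<open>p\<close>, this compares
  \<open>p^(a - b)\<close> with \<open>p^(c - d)\<close> while all exponents stay natural
  numbers.\<close>

lemma power_mult_inverse_power_eq:
  fixes p z :: "'a::comm_ring_1"
  assumes "p * z = 1" and "a + d = c + b"
  shows "p ^ a * z ^ b = p ^ c * z ^ d"
proof -
  have pz: "p ^ k * z ^ k = 1" for k
    by (simp add: assms(1) power_mult_distrib[symmetric])
  have "p ^ a * z ^ b = p ^ a * z ^ b * (p ^ d * z ^ d)"
    by (simp add: pz)
  also have "\<dots> = p ^ (a + d) * z ^ (b + d)"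
    by (simp add: power_add mult_ac)
  also have "\<dots> = p ^ c * z ^ d * (p ^ b * z ^ b)"
    unfolding assms(2) by (simp add: power_add mult_ac)
  finally show ?thesis by (simp add: pz)
qed

text \<open>The parameter \<open>z\<close> stands for \<open>p\<^bsup>-1\<^esup>\<close>.\<close>

definition theta_term :: "'a::comm_ring_1 \<Rightarrow> 'a \<Rightarrow> nat \<Rightarrow> nat \<Rightarrow> 'a" where
  "theta_term p z j v = (- 1) ^ v * (p ^ triangle v * z ^ (j * v))"

text \<open>The reflection of \<open>v\<close> to \<open>2 * j - 1 - v\<close> preserves the
  exponent \<open>v(v+1)/2 - jv\<close> and reverses the sign.\<close>

lemma theta_sum_zero:
  fixes p z :: "'a::field_char_0"
  assumes "p * z = 1"
  shows "(\<Sum>v<2 * j. theta_term p z j v) = 0"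
proof -
  have antisym: "theta_term p z j (2 * j - Suc v) = - theta_term p z j v" if "v < 2 * j" for v
  proof -
    define w where "w = 2 * j - Suc v"
    have j: "2 * j = Suc (v + w)" using that by (simp add: w_def)
    have "2 * (triangle w + j * v) = 2 * (triangle v + j * w)"
    proof -
      have "2 * (triangle w + j * v) = w * Suc w + (2 * j) * v"
        by (simp only: distrib_left double_triangle mult.assoc)
      also have "\<dots> = v * Suc v + (2 * j) * w"
        unfolding j by (simp add: algebra_simps)
      finally show ?thesis by (simp only: distrib_left double_triangle mult.assoc)
    qed
    then have "p ^ triangle w * z ^ (j * w) = p ^ triangle v * z ^ (j * v)"
      by (intro power_mult_inverse_power_eq assms) simp
    moreover have "(- 1 :: 'a) ^ w = - ((- 1) ^ v)"
    proof -
      have "odd (v + w)" using j by presburger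
      then have "(- 1 :: 'a) ^ (v + w) = - 1" by simp
      then have "(- 1 :: 'a) ^ v * ((- 1) ^ v * (- 1) ^ w) = - ((- 1) ^ v)"
        by (simp add: power_add)
      then show ?thesis by (simp only: mult.assoc[symmetric] power_mult_distrib[symmetric]) simp
    qed
    ultimately show ?thesis
      by (simp add: theta_term_def flip: w_def)
  qed
  have "(\<Sum>v<2 * j. theta_term p z j v) = (\<Sum>v<2 * j. theta_term p z j (2 * j - Suc v))"
    by (rule sum.nat_diff_reindex[symmetric])
  also have "\<dots> = - (\<Sum>v<2 * j. theta_term p z j v)"
    by (simp add: antisym flip: sum_negf)
  finally show ?thesis by simp
qed

text \<open>The theta term for \<open>s\<close> is \<open>p^v\<close> times that for
  \<open>s + 1\<close>, so \<open>1 / (1 - x) = 1 + x / (1 - x)\<close> at \<open>x = p^v\<close>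
  splits each summand into a bare theta term and a summand for \<open>s\<close>. The bare terms add
  up to zero.\<close>

lemma theta_lambert_step:
  fixes p z :: "'a::field_char_0"
  assumes pz: "p * z = 1" and ne: "\<And>v. 0 < v \<Longrightarrow> v \<le> 2 * s \<Longrightarrow> p ^ v \<noteq> 1"
  shows "(\<Sum>v = 1..2 * s + 1. theta_term p z (Suc s) v / (1 - p ^ v))
    = (\<Sum>v = 1..2 * s. theta_term p z s v / (1 - p ^ v)) - 1 / (1 - p ^ (2 * s + 1))"
proof -
  have last: "theta_term p z (Suc s) (2 * s + 1) = - 1"
  proof -
    have "2 * triangle (2 * s + 1) = 2 * (Suc s * (2 * s + 1))"
      unfolding double_triangle by (simp add: algebra_simps)
    then have "p ^ triangle (2 * s + 1) * z ^ (Suc s * (2 * s + 1)) = p ^ 0 * z ^ 0"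
      by (intro power_mult_inverse_power_eq pz) simp
    then show ?thesis by (simp add: theta_term_def)
  qed
  have shift: "theta_term p z s v = theta_term p z (Suc s) v * p ^ v" for v
  proof -
    have "p ^ triangle v * z ^ (s * v) = p ^ (triangle v + v) * z ^ (Suc s * v)"
      by (intro power_mult_inverse_power_eq pz) simp
    then show ?thesis by (simp add: theta_term_def power_add mult_ac)
  qed
  \<comment> \<open>In the full vanishing sum the end terms \<open>v = 0\<close> and
    \<open>v = 2 * s + 1\<close> are 1 and -1, so the inner terms vanish in total as well.\<close>
  have "{..<2 * Suc s} = insert 0 (insert (2 * s + 1) {1..2 * s})" by auto
  then have "0 = theta_term p z (Suc s) 0 + (theta_term p z (Suc s) (2 * s + 1)
      + (\<Sum>v = 1..2 * s. theta_term p z (Suc s) v))"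
    using theta_sum_zero[OF pz, of "Suc s"] by simp
  then have mid: "(\<Sum>v = 1..2 * s. theta_term p z (Suc s) v) = 0"
    unfolding last by (simp add: theta_term_def)
  have "theta_term p z (Suc s) v / (1 - p ^ v) = theta_term p z (Suc s) v + theta_term p z s v / (1 - p ^ v)"
    if "v \<in> {1..2 * s}" for v
    using ne[of v] that unfolding shift by (simp add: field_simps)
  then have "(\<Sum>v = 1..2 * s. theta_term p z (Suc s) v / (1 - p ^ v))
    = (\<Sum>v = 1..2 * s. theta_term p z (Suc s) v + theta_term p z s v / (1 - p ^ v))"
    by (intro sum.cong) auto
  also have "\<dots> = (\<Sum>v = 1..2 * s. theta_term p z s v / (1 - p ^ v))"
    by (simp only: sum.distrib mid add_0_left)
  finally show ?thesis
    using last by simp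
qed

text \<open>Raising \<open>s\<close> adds the summands \<open>v = 2 * s + 1\<close>, covered by the
  step lemma, and \<open>v = 2 * s + 2\<close>.\<close>

lemma theta_lambert_even:
  fixes p z :: "'a::field_char_0"
  assumes pz: "p * z = 1" and "\<And>v. 0 < v \<Longrightarrow> v \<le> 2 * s \<Longrightarrow> p ^ v \<noteq> 1"
  shows "(\<Sum>v = 1..2 * s. theta_term p z s v / (1 - p ^ v)) = - (\<Sum>i = s + 1..2 * s. 1 / (1 - p ^ i))"
  using assms(2)
proof (induction s)
  case 0
  then show ?case by simp
next
  case (Suc s)
  have last: "theta_term p z (Suc s) (2 * Suc s) = p ^ Suc s"
  proof -
    have "2 * triangle (2 * Suc s) = 2 * (Suc s + Suc s * (2 * Suc s))"
      unfolding double_triangle by (simp add: algebra_simps)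
    then have "p ^ triangle (2 * Suc s) * z ^ (Suc s * (2 * Suc s)) = p ^ Suc s * z ^ 0"
      by (intro power_mult_inverse_power_eq pz) simp
    then show ?thesis by (simp add: theta_term_def)
  qed
  define x where "x = p ^ Suc s"
  have x2: "p ^ (2 * Suc s) = x * x"
    by (simp add: x_def mult_2 power_add[symmetric])
  have nz: "1 - x \<noteq> 0" "1 - x * x \<noteq> 0"
    using Suc.prems[of "Suc s"] Suc.prems[of "2 * Suc s"] unfolding x2 by (simp_all add: x_def)
  \<comment> \<open>This splits the summand \<open>v = 2 * s + 2\<close>: the first fraction removes
    \<open>i = s + 1\<close> from the right-hand range, the second adds
    \<open>i = 2 * s + 2\<close>.\<close>
  have frac: "x / (1 - x * x) = 1 / (1 - x) - 1 / (1 - x * x)"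
    using nz by (simp add: divide_simps) (simp add: algebra_simps)
  have "(\<Sum>v = 1..2 * Suc s. theta_term p z (Suc s) v / (1 - p ^ v))
    = (\<Sum>v = 1..2 * s + 1. theta_term p z (Suc s) v / (1 - p ^ v)) + x / (1 - x * x)"
    using last x2 by (simp add: x_def)
  also have "\<dots> = - (\<Sum>i = s + 1..2 * s. 1 / (1 - p ^ i)) - 1 / (1 - p ^ (2 * s + 1))
      + (1 / (1 - x) - 1 / (1 - x * x))"
    using Suc by (subst theta_lambert_step[OF pz]) (simp_all add: frac)
  also have "\<dots> = - (\<Sum>i = Suc s + 1..2 * Suc s. 1 / (1 - p ^ i))"
  proof -
    define f where "f = (\<lambda>i. 1 / (1 - p ^ i))"
    have "sum f {s + 1..2 * s + 2} = sum f {s + 1..2 * s} + f (2 * s + 1) + f (2 * s + 2)"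
      by simp
    moreover have "sum f {s + 1..2 * s + 2} = f (Suc s) + sum f {Suc s + 1..2 * s + 2}"
      by (subst sum.atLeast_Suc_atMost) simp_all
    moreover have "f (Suc s) = 1 / (1 - x)" "f (2 * s + 2) = 1 / (1 - x * x)"
      using x2 by (simp_all add: f_def x_def)
    ultimately show ?thesis
      unfolding f_def[symmetric] fun_cong[OF f_def, symmetric] by (simp add: algebra_simps)
  qed
  finally show ?case .
qed

text \<open>Half a step of the preceding induction: parameter \<open>s + 1\<close>, with the summand
  \<open>v = 2 * s + 2\<close> left out.\<close>

lemma theta_lambert_odd:
  fixes p z :: "'a::field_char_0"
  assumes pz: "p * z = 1" and "\<And>v. 0 < v \<Longrightarrow> v \<le> 2 * s \<Longrightarrow> p ^ v \<noteq> 1"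
  shows "(\<Sum>v = 1..2 * s + 1. theta_term p z (Suc s) v / (1 - p ^ v))
    = - (\<Sum>i = s + 1..2 * s + 1. 1 / (1 - p ^ i))"
  using theta_lambert_step[OF assms] theta_lambert_even[OF assms] by simp

text \<open>Completing the square about the middle of the range: the common factor turns the theta
  terms at distance \<open>r\<close> on either side into the weight
  \<open>(- 1) ^ r * p ^ triangle r\<close>, with opposite signs. The first two parts serve n = 1
  mod 3, the last two n = 2 mod 3.\<close>

lemma theta_term_complement:
  fixes p z :: "'a::field_char_0"
  assumes pz: "p * z = 1"
  shows "(- 1) ^ (r + v) * p ^ triangle (r + v) * theta_term p z (r + v) v
      = (- 1) ^ r * p ^ triangle r * p ^ v"
    and "(- 1) ^ t * p ^ triangle t * theta_term p z t (t + 1 + r)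
      = - ((- 1) ^ r * p ^ triangle r * p ^ (t + 1 + r))"
    and "(- 1) ^ (r + v) * p ^ triangle (r + v) * theta_term p z (Suc (r + v)) v
      = (- 1) ^ r * p ^ triangle r"
    and "(- 1) ^ t * p ^ triangle t * theta_term p z (Suc t) (t + 1 + r)
      = - ((- 1) ^ r * p ^ triangle r)"
proof -
  have sign: "(- 1 :: 'a) ^ (r + v) * (- 1) ^ v = (- 1) ^ r"
    by (simp add: power_add mult.assoc flip: power_mult_distrib)
  have sign': "(- 1 :: 'a) ^ t * (- 1) ^ (t + 1 + r) = - ((- 1) ^ r)"
    by (simp add: power_add mult.assoc[symmetric] flip: power_mult_distrib)
  have e: "triangle (r + v) + triangle v = triangle r + v + (r + v) * v"
  proof -
    have "2 * (triangle (r + v) + triangle v) = 2 * (triangle r + v + (r + v) * v)"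
      by (simp only: distrib_left double_triangle) (simp add: algebra_simps)
    then show ?thesis by simp
  qed
  have e': "triangle t + triangle (t + 1 + r) = triangle r + (t + 1 + r) + t * (t + 1 + r)"
  proof -
    have "2 * (triangle t + triangle (t + 1 + r)) = 2 * (triangle r + (t + 1 + r) + t * (t + 1 + r))"
      by (simp only: distrib_left double_triangle) (simp add: algebra_simps)
    then show ?thesis by simp
  qed
  have "p ^ (triangle (r + v) + triangle v) * z ^ ((r + v) * v) = p ^ (triangle r + v) * z ^ 0"
    by (rule power_mult_inverse_power_eq[OF pz]) (simp add: e)
  then have 1: "p ^ triangle (r + v) * (p ^ triangle v * z ^ ((r + v) * v)) = p ^ triangle r * p ^ v"
    by (simp add: power_add mult.assoc)
  have "p ^ (triangle (r + v) + triangle v) * z ^ (Suc (r + v) * v) = p ^ triangle r * z ^ 0"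
    by (rule power_mult_inverse_power_eq[OF pz]) (simp add: e)
  then have 3: "p ^ triangle (r + v) * (p ^ triangle v * z ^ (Suc (r + v) * v)) = p ^ triangle r"
    by (simp add: power_add mult.assoc)
  have "p ^ (triangle t + triangle (t + 1 + r)) * z ^ (t * (t + 1 + r))
      = p ^ (triangle r + (t + 1 + r)) * z ^ 0"
    by (rule power_mult_inverse_power_eq[OF pz]) (simp only: e' add_0_right)
  then have 2: "p ^ triangle t * (p ^ triangle (t + 1 + r) * z ^ (t * (t + 1 + r)))
      = p ^ triangle r * p ^ (t + 1 + r)"
    by (simp only: power_add mult.assoc power_0 mult_1_right)
  have "p ^ (triangle t + triangle (t + 1 + r)) * z ^ (Suc t * (t + 1 + r)) = p ^ triangle r * z ^ 0"
    by (rule power_mult_inverse_power_eq[OF pz]) (simp only: e' add_0_right mult_Suc add.assoc[of _ _ "t * _"])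
  then have 4: "p ^ triangle t * (p ^ triangle (t + 1 + r) * z ^ (Suc t * (t + 1 + r))) = p ^ triangle r"
    by (simp only: power_add mult.assoc power_0 mult_1_right)
  have comb: "x * y * (x' * y') = s * u" if "x * x' = s" "y * y' = u" for x y x' y' s u :: 'a
    unfolding that[symmetric] by (simp only: mult_ac)
  show "(- 1) ^ (r + v) * p ^ triangle (r + v) * theta_term p z (r + v) v
      = (- 1) ^ r * p ^ triangle r * p ^ v"
    unfolding theta_term_def comb[OF sign 1] by (simp only: mult.assoc)
  show "(- 1) ^ t * p ^ triangle t * theta_term p z t (t + 1 + r)
      = - ((- 1) ^ r * p ^ triangle r * p ^ (t + 1 + r))"
    unfolding theta_term_def comb[OF sign' 2] by (simp only: mult.assoc mult_minus_left)
  show "(- 1) ^ (r + v) * p ^ triangle (r + v) * theta_term p z (Suc (r + v)) v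
      = (- 1) ^ r * p ^ triangle r"
    unfolding theta_term_def comb[OF sign 3] ..
  show "(- 1) ^ t * p ^ triangle t * theta_term p z (Suc t) (t + 1 + r)
      = - ((- 1) ^ r * p ^ triangle r)"
    unfolding theta_term_def comb[OF sign' 4] by (simp only: mult_minus_left)
qed

text \<open>Reading the range outward from its middle assigns two values of \<open>v\<close> to each
  \<open>r\<close>, just as each \<open>tauraso_term\<close> has two parts.\<close>

lemma sum_split_middle:
  fixes f :: "nat \<Rightarrow> 'a::comm_monoid_add"
  shows "(\<Sum>v = 1..2 * t. f v) = (\<Sum>r<t. f (t - r) + f (t + 1 + r))"
proof -
  have "{1..2 * t} = {1..t} \<union> {t + 1..2 * t}" by auto
  then have "(\<Sum>v = 1..2 * t. f v) = sum f {1..t} + sum f {t + 1..2 * t}"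
    by (simp only:) (rule sum.union_disjoint, auto)
  also have "sum f {1..t} = (\<Sum>r<t. f (t - r))"
    by (rule sum.reindex_bij_witness[of _ "\<lambda>r. t - r" "\<lambda>v. t - v"]) auto
  also have "sum f {t + 1..2 * t} = (\<Sum>r<t. f (t + 1 + r))"
    by (rule sum.reindex_bij_witness[of _ "\<lambda>r. t + 1 + r" "\<lambda>v. v - (t + 1)"]) auto
  finally show ?thesis by (simp only: sum.distrib)
qed

text \<open>Pairing \<open>i\<close> with \<open>a + b - i\<close> works because
  \<open>x * y = 1\<close> gives \<open>1 / (1 - x) + 1 / (1 - y) = 1\<close>; each summand thus
  counts 1/2 on average.\<close>

lemma sum_inverse_one_minus:
  fixes p :: "'a::field_char_0"
  assumes "p ^ (a + b) = 1" and "\<And>i. a \<le> i \<Longrightarrow> i \<le> b \<Longrightarrow> p ^ i \<noteq> 1"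
  shows "(\<Sum>i = a..b. 1 / (1 - p ^ i)) = of_nat (Suc b - a) / 2"
proof -
  let ?S = "\<Sum>i = a..b. 1 / (1 - p ^ i)"
  have "?S = (\<Sum>i = a..b. 1 / (1 - p ^ (b + a - i)))"
    by (rule sum.atLeastAtMost_rev)
  then have "?S + ?S = (\<Sum>i = a..b. 1 / (1 - p ^ i) + 1 / (1 - p ^ (b + a - i)))"
    by (simp only: sum.distrib)
  also have "\<dots> = (\<Sum>i = a..b. 1)"
  proof (rule sum.cong[OF refl])
    fix i assume i: "i \<in> {a..b}"
    have "p ^ i * p ^ (b + a - i) = 1"
      using i assms(1) by (simp only: power_add[symmetric]) (simp add: add.commute)
    moreover have "p ^ i \<noteq> 1"
      using i by (intro assms(2)) simp_all
    moreover have "p ^ (b + a - i) \<noteq> 1"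
      using i by (intro assms(2)) auto
    ultimately show "1 / (1 - p ^ i) + 1 / (1 - p ^ (b + a - i)) = 1"
      by (simp add: divide_simps) (simp add: algebra_simps)
  qed
  finally show ?thesis by (simp add: field_simps)
qed

section \<open>Values and derivatives at a complex point\<close>

definition ev :: "complex \<Rightarrow> int poly \<Rightarrow> complex" where
  "ev z P = poly (map_poly of_int P) z"

definition dv :: "complex \<Rightarrow> int poly \<Rightarrow> complex" where
  "dv z P = poly (pderiv (map_poly of_int P)) z"

lemma of_int_poly_diff:
  "map_poly of_int (p - q) = (map_poly of_int p - map_poly of_int q :: complex poly)"
  by (rule poly_eqI) (simp add: coeff_map_poly)

lemma of_int_poly_of_int: "map_poly of_int (of_int c) = (of_int c :: complex poly)"
  by (simp add: of_int_poly map_poly_pCons)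

lemma ev_0 [simp]: "ev z 0 = 0"
  and ev_1 [simp]: "ev z 1 = 1"
  and ev_qvar [simp]: "ev z qvar = z"
  and ev_of_int [simp]: "ev z (of_int c) = of_int c"
  and ev_add [simp]: "ev z (P + Q) = ev z P + ev z Q"
  and ev_diff [simp]: "ev z (P - Q) = ev z P - ev z Q"
  and ev_mult [simp]: "ev z (P * Q) = ev z P * ev z Q"
  by (simp_all add: ev_def of_int_poly_add of_int_poly_diff of_int_poly_mult map_poly_pCons
      of_int_poly_of_int)

lemma ev_power [simp]: "ev z (P ^ k) = ev z P ^ k"
  by (induction k) simp_all

lemma ev_sum [simp]: "ev z (sum f A) = (\<Sum>x\<in>A. ev z (f x))"
  by (induction A rule: infinite_finite_induct) simp_all

lemma ev_prod [simp]: "ev z (prod f A) = (\<Prod>x\<in>A. ev z (f x))"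
  by (induction A rule: infinite_finite_induct) simp_all

lemma dv_0 [simp]: "dv z 0 = 0"
  and dv_1 [simp]: "dv z 1 = 0"
  and dv_qvar [simp]: "dv z qvar = 1"
  and dv_of_int [simp]: "dv z (of_int c) = 0"
  and dv_add [simp]: "dv z (P + Q) = dv z P + dv z Q"
  and dv_diff [simp]: "dv z (P - Q) = dv z P - dv z Q"
  and dv_mult: "dv z (P * Q) = ev z P * dv z Q + ev z Q * dv z P"
  by (simp_all add: dv_def ev_def of_int_poly_add of_int_poly_diff of_int_poly_mult map_poly_pCons
      of_int_poly pderiv_add pderiv_diff pderiv_mult pderiv_pCons)

lemma ev_pCons [simp]: "ev z (pCons a P) = of_int a + z * ev z P"
  by (simp add: ev_def map_poly_pCons)

lemma dv_pCons [simp]: "dv z (pCons a P) = ev z P + z * dv z P"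
  by (simp add: ev_def dv_def map_poly_pCons pderiv_pCons)

lemma dv_sum [simp]: "dv z (sum f A) = (\<Sum>x\<in>A. dv z (f x))"
  by (induction A rule: infinite_finite_induct) simp_all

text \<open>The factor \<open>z\<close> avoids the exponent \<open>k - 1\<close>; derivatives are
  therefore compared after multiplication by \<open>z\<close> throughout.\<close>

lemma dv_qvar_power: "z * dv z (qvar ^ k) = of_nat k * z ^ k"
  by (induction k) (simp_all add: dv_mult algebra_simps)

section \<open>Divisibility by the squared cyclotomic polynomial from double roots\<close>

lemma double_root_dvd:
  fixes F :: "'a::idom poly"
  assumes "poly F z = 0" and "poly (pderiv F) z = 0"
  shows "[:- z, 1:]\<^sup>2 dvd F"
proof -
  obtain G where F: "F = [:- z, 1:] * G"
    using assms(1) by (auto simp: poly_eq_0_iff_dvd dvd_def)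
  have "poly G z = 0"
    using assms(2) unfolding F pderiv_mult by (simp add: pderiv_pCons)
  then obtain H where "G = [:- z, 1:] * H"
    by (auto simp: poly_eq_0_iff_dvd dvd_def)
  then show ?thesis
    unfolding F by (simp only: power2_eq_square mult.assoc[symmetric] dvd_triv_left)
qed

text \<open>The square split off so far does not vanish at the next root, so the double zero there
  passes to the cofactor.\<close>

lemma prod_linear_squared_dvd:
  fixes F :: "'a::idom poly"
  assumes "finite S" and "inj_on w S"
    and "\<And>k. k \<in> S \<Longrightarrow> poly F (w k) = 0 \<and> poly (pderiv F) (w k) = 0"
  shows "(\<Prod>k\<in>S. [:- w k, 1:])\<^sup>2 dvd F"
  using assms
proof (induction S)
  case empty
  then show ?case by simp
next
  case (insert k S)
  define A where "A = (\<Prod>k\<in>S. [:- w k, 1:])"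
  have A: "poly A (w k) \<noteq> 0"
    using insert.hyps insert.prems(1) by (auto simp: A_def poly_prod inj_on_def)
  obtain G where F: "F = A\<^sup>2 * G"
    using insert by (auto simp: A_def inj_on_def dvd_def)
  have G: "poly G (w k) = 0"
    using insert.prems(2)[of k] A by (simp add: F)
  have "poly (pderiv G) (w k) = 0"
    using insert.prems(2)[of k] A G by (simp add: F pderiv_mult)
  from double_root_dvd[OF G this] have "[:- w k, 1:]\<^sup>2 * A\<^sup>2 dvd G * A\<^sup>2"
    by (rule mult_dvd_mono) simp
  then show ?case
    using insert.hyps by (simp add: power_mult_distrib F A_def mult.commute del: mult_pCons_left)
qed

text \<open>Exact order \<open>n\<close> is all that the evaluations below use; the exponential form
  of the root is needed only for divisibility.\<close>

definition primitive_root :: "nat \<Rightarrow> complex \<Rightarrow> bool" where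
  "primitive_root n z \<longleftrightarrow> n > 0 \<and> z ^ n = 1 \<and> (\<forall>k. 0 < k \<longrightarrow> k < n \<longrightarrow> z ^ k \<noteq> 1)"

text \<open>Every root is a power of \<open>w 1\<close>, whose powers are determined by the exponent
  mod \<open>n\<close>; coprimality of \<open>k\<close> and \<open>n\<close> then gives
  \<open>w k\<close> the exact order \<open>n\<close>.\<close>

lemma roots_of_cyclotomic:
  assumes "n > 0"
  defines "w \<equiv> \<lambda>k. exp (2 * of_real pi * \<i> * of_nat k / of_nat n) :: complex"
    and "S \<equiv> {k. 1 \<le> k \<and> k \<le> n \<and> gcd n k = 1}"
  shows "inj_on w S" and "k \<in> S \<Longrightarrow> primitive_root n (w k)"
proof -
  have w: "w k = cis (2 * pi * real k / real n)" for k
    by (simp add: w_def cis_conv_exp mult_ac)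
  have inj: "inj_on w {..<n}"
    using bij_betw_roots_unity[OF assms(1)] by (simp add: w[abs_def] bij_betw_def)
  have w1: "w 1 ^ n = 1"
    using assms(1) by (simp add: w DeMoivre)
  have wpow: "w k ^ j = w 1 ^ (k * j)" for k j
    by (simp add: w DeMoivre field_simps)
  have wmod: "w 1 ^ k = w (k mod n)" for k
  proof -
    have "w 1 ^ k = w 1 ^ (n * (k div n) + k mod n)" by simp
    also have "\<dots> = w 1 ^ (k mod n)"
      by (simp only: power_add power_mult w1) simp
    also have "\<dots> = w (k mod n)" using wpow[of "k mod n" 1] by simp
    finally show ?thesis .
  qed
  have eq: "w 1 ^ j = w 1 ^ k \<longleftrightarrow> j mod n = k mod n" for j k
    using assms(1) unfolding wmod by (auto dest: inj_onD[OF inj])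
  show "inj_on w S"
  proof (rule inj_onI)
    fix j k assume jk: "j \<in> S" "k \<in> S" "w j = w k"
    then have "j mod n = k mod n"
      using eq[of j k] wpow[of j 1] wpow[of k 1] by simp
    \<comment> \<open>Indices run over \<open>1..n\<close>, not over residues: \<open>n\<close> has
      residue 0, which no other index has.\<close>
    moreover have "i = n \<or> i = i mod n" if "i \<in> S" for i
      using that by (cases "i = n") (auto simp: S_def)
    moreover have "i \<noteq> 0" if "i \<in> S" for i
      using that by (auto simp: S_def)
    ultimately show "j = k" using jk by (metis mod_self)
  qed
  assume k: "k \<in> S"
  have "w k ^ j = 1 \<longleftrightarrow> n dvd k * j" for j
    using eq[of "k * j" 0] by (simp add: wpow[of k j] mod_eq_0_iff_dvd)
  moreover have "coprime n k"
    using k unfolding S_def coprime_iff_gcd_eq_1 by blast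
  ultimately have "w k ^ j = 1 \<longleftrightarrow> n dvd j" for j
    by (simp only: coprime_dvd_mult_right_iff)
  then show "primitive_root n (w k)"
    using assms(1) by (auto simp: primitive_root_def dest: dvd_imp_le)
qed

text \<open>The squared cyclotomic polynomial is monic with integer coefficients, so the complex
  quotient is integral too.\<close>

lemma cyclotomic_squared_dvd:
  assumes "n > 0"
    and "\<And>z. primitive_root n z \<Longrightarrow> ev z P = 0 \<and> dv z P = 0"
  shows "(cyclotomic n)\<^sup>2 dvd P"
proof -
  let ?h = "map_poly of_int :: int poly \<Rightarrow> complex poly"
  have sq: "?h ((cyclotomic n)\<^sup>2) = (complex_cyclotomic n)\<^sup>2"
    by (simp add: power2_eq_square of_int_poly_mult of_int_cyclotomic)
  have "(complex_cyclotomic n)\<^sup>2 dvd ?h P"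
    unfolding complex_cyclotomic_def
  proof (rule prod_linear_squared_dvd)
    fix k assume "k \<in> {k. 1 \<le> k \<and> k \<le> n \<and> gcd n k = 1}"
    from assms(2)[OF roots_of_cyclotomic(2)[OF assms(1) this]]
    show "poly (?h P) (exp (2 * of_real pi * \<i> * of_nat k / of_nat n)) = 0
        \<and> poly (pderiv (?h P)) (exp (2 * of_real pi * \<i> * of_nat k / of_nat n)) = 0"
      by (simp add: ev_def dv_def)
  qed (use roots_of_cyclotomic(1)[OF assms(1)] in simp_all)
  then obtain F where F: "?h P = ?h ((cyclotomic n)\<^sup>2) * F"
    unfolding sq by (rule dvdE)
  have "lead_coeff (?h ((cyclotomic n)\<^sup>2)) = 1"
    unfolding sq by (simp only: lead_coeff_power complex_cyclotomic_monic power_one)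
  then have "lead_coeff ((cyclotomic n)\<^sup>2) = 1"
    by (simp add: degree_map_poly coeff_map_poly)
  then obtain Q where "?h Q = F"
    using of_int_poly_monic_quotient F by metis
  then have "P = (cyclotomic n)\<^sup>2 * Q"
    using F by (intro of_int_poly_inj) (simp add: of_int_poly_mult)
  then show ?thesis by (rule dvdI)
qed

section \<open>Evaluation at a primitive root of unity\<close>

context
  fixes n :: nat and z :: complex
  assumes prim: "primitive_root n z"
begin

lemma period_pos: "n > 0" and power_period: "z ^ n = 1"
  and power_neq_1: "0 < k \<Longrightarrow> k < n \<Longrightarrow> z ^ k \<noteq> 1"
  using prim by (auto simp: primitive_root_def)

lemma z_nonzero: "z \<noteq> 0"
  using power_period period_pos by (auto simp: power_0_left)

lemma power_mult_n: "z ^ (n * k) = 1"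
  by (simp add: power_mult power_period)

lemma power_eq_1_iff: "z ^ k = 1 \<longleftrightarrow> n dvd k"
proof -
  have "z ^ k = z ^ (n * (k div n) + k mod n)" by simp
  also have "\<dots> = z ^ (k mod n)" by (simp only: power_add power_mult_n mult_1_left)
  finally show ?thesis
    using power_neq_1[of "k mod n"] period_pos by (auto simp: mod_eq_0_iff_dvd)
qed

text \<open>For even \<open>n\<close> the power \<open>z ^ (n div 2)\<close> is -1; for odd
  \<open>n\<close> the number \<open>b\<close> must be even and both sides are 1. This evaluates
  exponents coming from triangular numbers.\<close>

lemma half_power:
  assumes "2 * a = n * b"
  shows "z ^ a = (- 1) ^ b"
proof (cases "even n")
  case True
  then obtain m where m: "n = 2 * m" by (rule evenE)
  have "(z ^ m)\<^sup>2 = 1" using power_period by (simp add: m power_mult[symmetric] mult.commute)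
  moreover have "z ^ m \<noteq> 1" using power_neq_1[of m] period_pos by (simp add: m)
  ultimately have "z ^ m = - 1" by (simp add: power2_eq_1_iff)
  moreover have "a = m * b" using assms by (simp add: m)
  ultimately show ?thesis by (simp add: power_mult)
next
  case False
  then obtain c where c: "b = 2 * c" using assms by (metis even_mult_iff dvd_triv_left evenE)
  then have "a = n * c" using assms by simp
  then show ?thesis by (simp add: power_mult_n c)
qed

lemma half_period_shift:
  assumes "2 * a = 2 * c + n * b"
  shows "z ^ a = (- 1) ^ b * z ^ c"
proof -
  have "a = c + (a - c)" "2 * (a - c) = n * b"
    using assms by simp_all
  then show ?thesis
    using half_power by (metis power_add mult.commute)
qed

section \<open>Gaussian binomials and their derivatives at the root\<close>

lemma ev_q_pochhammer_eq_0_iff: "ev z (q_pochhammer qvar qvar m) = 0 \<longleftrightarrow> n \<le> m"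
proof -
  have "ev z (q_pochhammer qvar qvar m) = 0 \<longleftrightarrow> (\<exists>i<m. z ^ Suc i = 1)"
    by (auto simp: q_pochhammer_def)
  also have "\<dots> \<longleftrightarrow> (\<exists>i<m. n dvd Suc i)"
    by (simp only: power_eq_1_iff)
  also have "\<dots> \<longleftrightarrow> n \<le> m"
  proof
    assume "n \<le> m"
    then show "\<exists>i<m. n dvd Suc i" using period_pos by (intro exI[of _ "n - 1"]) simp
  qed (auto dest: dvd_imp_le)
  finally show ?thesis .
qed

text \<open>The Pochhammer product on top contains the factor for exponent \<open>n\<close>, and
  neither product below does.\<close>

lemma ev_gauss_binomial_eq_0:
  assumes "i < n" "j < n" "n \<le> i + j"
  shows "ev z (gauss_binomial (i + j) i) = 0"
proof -
  let ?P = "q_pochhammer qvar qvar"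
  have "ev z (gauss_binomial (i + j) i) * (ev z (?P i) * ev z (?P j)) = ev z (?P (i + j))"
    using gauss_binomial_mult[of i "i + j"] by (metis add_diff_cancel_left' ev_mult le_add1)
  then show ?thesis
    using assms ev_q_pochhammer_eq_0_iff[of i] ev_q_pochhammer_eq_0_iff[of j]
      ev_q_pochhammer_eq_0_iff[of "i + j"] by auto
qed

text \<open>In the q-Vandermonde sum only \<open>j = 0\<close> and \<open>j = n\<close> survive at
  \<open>z\<close>, each contributing 1.\<close>

lemma ev_gauss_binomial_2n_n: "ev z (gauss_binomial (2 * n) n) = 2"
proof -
  let ?f = "\<lambda>j. z ^ j\<^sup>2 * (ev z (gauss_binomial n j))\<^sup>2"
  have "ev z (gauss_binomial (2 * n) n) = (\<Sum>j\<le>n. ?f j)"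
    by (simp flip: q_Vandermonde_central)
  also have "\<dots> = (\<Sum>j\<in>{0, n}. ?f j)"
  proof (rule sum.mono_neutral_right)
    show "\<forall>j\<in>{..n} - {0, n}. ?f j = 0"
    proof
      fix j assume "j \<in> {..n} - {0, n}"
      then show "?f j = 0"
        using ev_gauss_binomial_eq_0[of j "n - j"] by simp
    qed
  qed auto
  also have "\<dots> = 2"
    using period_pos by (simp add: power2_eq_square power_mult_n)
  finally show ?thesis .
qed

text \<open>Evaluating and differentiating the ratio relation at \<open>z\<close> gives recursions
  in \<open>m\<close>. The value 2 at \<open>m = 0\<close> starts the derivatives; each later step
  multiplies \<open>(1 - z ^ m) * dv z (b m)\<close> by \<open>- 1 / z ^ m\<close>, which
  accumulates to the sign and the triangular exponent.\<close>

lemma gauss_binomial_2n_at_root: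
  assumes "Suc i < n"
  defines "b \<equiv> \<lambda>m. gauss_binomial (2 * n) (n + m)"
  shows "ev z (b (Suc i)) = 0"
    and "z ^ Suc (triangle i) * (1 - z ^ Suc i) * dv z (b (Suc i)) = - 2 * of_nat n * (- 1) ^ i"
proof -
  have ratio: "(1 - qvar ^ (n - m)) * b m = (1 - qvar ^ (n + Suc m)) * b (Suc m)" for m
    using gauss_binomial_ratio[of "2 * n" "n + m"] by (simp add: b_def)
  have z_n: "z ^ (n + m) = z ^ m" for m
    by (simp add: power_add power_period)
  have ev_ratio: "(1 - z ^ (n - m)) * ev z (b m) = (1 - z ^ Suc m) * ev z (b (Suc m))" for m
    using arg_cong[OF ratio[of m], of "ev z"] by (simp only: ev_mult ev_diff ev_1 ev_power ev_qvar z_n)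
  have dv_ratio: "(1 - z ^ (n - m)) * dv z (b m) - ev z (b m) * dv z (qvar ^ (n - m))
      = (1 - z ^ Suc m) * dv z (b (Suc m)) - ev z (b (Suc m)) * dv z (qvar ^ (n + Suc m))" for m
    using arg_cong[OF ratio[of m], of "dv z"]
    by (simp only: ev_diff ev_1 ev_power ev_qvar z_n dv_mult dv_diff dv_1)
      (simp only: diff_0 mult_minus_right uminus_add_conv_diff add_uminus_conv_diff)
  have "ev z (b (Suc i)) = 0
    \<and> z ^ Suc (triangle i) * (1 - z ^ Suc i) * dv z (b (Suc i)) = - 2 * of_nat n * (- 1) ^ i"
    using assms(1)
  proof (induction i)
    case 0
    have b0: "ev z (b 0) = 2"
      by (simp add: b_def ev_gauss_binomial_2n_n)
    have e: "ev z (b 1) = 0"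
      using ev_ratio[of 0] power_neq_1[of 1] 0 by (simp add: power_period)
    have "(1 - z) * dv z (b 1) = - 2 * dv z (qvar ^ n)"
      using dv_ratio[of 0] e by (simp add: power_period b0 del: dv_pCons)
    then have "z * ((1 - z) * dv z (b 1)) = - 2 * (z * dv z (qvar ^ n))"
      by simp
    then show ?case
      using e by (simp add: dv_qvar_power power_period mult.assoc)
  next
    case (Suc i)
    let ?m = "Suc i"
    have IH: "ev z (b ?m) = 0"
      "z ^ Suc (triangle i) * (1 - z ^ ?m) * dv z (b ?m) = - 2 * of_nat n * (- 1) ^ i"
      using Suc by simp_all
    have e: "ev z (b (Suc ?m)) = 0"
      using ev_ratio[of ?m] IH(1) power_neq_1[of "Suc ?m"] Suc.prems by simp
    have d: "(1 - z ^ Suc ?m) * dv z (b (Suc ?m)) = (1 - z ^ (n - ?m)) * dv z (b ?m)"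
      using dv_ratio[of ?m] by (simp add: IH(1) e)
    have "z ^ ?m * z ^ (n - ?m) = 1"
      using Suc.prems by (simp only: power_add[symmetric]) (simp add: power_period)
    then have r: "z ^ ?m * (1 - z ^ (n - ?m)) = - (1 - z ^ ?m)"
      by (simp add: right_diff_distrib)
    have "z ^ Suc (triangle ?m) * (1 - z ^ Suc ?m) * dv z (b (Suc ?m))
        = z ^ Suc (triangle i) * (z ^ ?m * ((1 - z ^ Suc ?m) * dv z (b (Suc ?m))))"
      by (simp only: triangle_Suc power_add power_Suc mult_ac)
    also have "\<dots> = z ^ Suc (triangle i) * (z ^ ?m * (1 - z ^ (n - ?m))) * dv z (b ?m)"
      unfolding d by (simp only: mult_ac)
    also have "\<dots> = - (z ^ Suc (triangle i) * (1 - z ^ ?m) * dv z (b ?m))"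
      unfolding r by (simp only: mult_minus_left mult_minus_right)
    finally show ?case
      unfolding IH(2) using e by simp
  qed
  then show "ev z (b (Suc i)) = 0"
    and "z ^ Suc (triangle i) * (1 - z ^ Suc i) * dv z (b (Suc i)) = - 2 * of_nat n * (- 1) ^ i"
    by auto
qed

section \<open>The terms of Tauraso's sum at the root\<close>

text \<open>The coefficient vanishes at \<open>z\<close>, so the product rule leaves only its
  derivative. The power of \<open>z\<close> absorbs the factor
  \<open>z ^ Suc (triangle (3 * r))\<close> from that derivative and leaves
  \<open>z ^ (3 * triangle r)\<close>.\<close>

lemma tauraso_first_at_root:
  assumes "3 * r + 1 < n"
  defines "P \<equiv> qvar ^ (6 * r\<^sup>2 + 3 * r) * gauss_binomial (2 * n) (n + (3 * r + 1))"
  shows "ev z P = 0"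
    and "z * dv z P = - 2 * of_nat n * ((- 1) ^ r * z ^ (3 * triangle r) * (1 / (1 - z ^ (3 * r + 1))))"
proof -
  let ?b = "gauss_binomial (2 * n) (n + (3 * r + 1))"
  have b: "ev z ?b = 0"
    "z ^ Suc (triangle (3 * r)) * (1 - z ^ (3 * r + 1)) * dv z ?b = - 2 * of_nat n * (- 1) ^ (3 * r)"
    using gauss_binomial_2n_at_root[of "3 * r"] assms by simp_all
  show "ev z P = 0"
    by (simp add: P_def b(1)[simplified])
  have e: "Suc (6 * r\<^sup>2 + 3 * r) = 3 * triangle r + Suc (triangle (3 * r))"
  proof -
    have "2 * Suc (6 * r\<^sup>2 + 3 * r) = 3 * (2 * triangle r) + 2 + 2 * triangle (3 * r)"
      unfolding double_triangle by (simp add: power2_eq_square algebra_simps)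
    then show ?thesis by simp
  qed
  have nz: "1 - z ^ (3 * r + 1) \<noteq> 0"
    using power_neq_1[of "3 * r + 1"] assms by simp
  have "z * dv z P = z ^ Suc (6 * r\<^sup>2 + 3 * r) * dv z ?b"
    unfolding P_def dv_mult b(1) by simp
  also have "\<dots> * (1 - z ^ (3 * r + 1))
      = z ^ (3 * triangle r) * (z ^ Suc (triangle (3 * r)) * (1 - z ^ (3 * r + 1)) * dv z ?b)"
    unfolding e by (simp only: power_add mult_ac)
  also have "\<dots> = - 2 * of_nat n * ((- 1) ^ r * z ^ (3 * triangle r))"
    unfolding b(2) by (simp add: power_mult)
  finally show "z * dv z P = - 2 * of_nat n * ((- 1) ^ r * z ^ (3 * triangle r) * (1 / (1 - z ^ (3 * r + 1))))"
    using nz by (simp add: field_simps)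
qed

text \<open>As for the first part, except that the exponents leave an additional factor
  \<open>z ^ (3 * r + 2)\<close>.\<close>

lemma tauraso_second_at_root:
  assumes "3 * r + 2 < n"
  defines "P \<equiv> qvar ^ (6 * r\<^sup>2 + 9 * r + 3) * gauss_binomial (2 * n) (n + (3 * r + 2))"
  shows "ev z P = 0"
    and "z * dv z P = 2 * of_nat n * ((- 1) ^ r * z ^ (3 * triangle r)
      * (z ^ (3 * r + 2) / (1 - z ^ (3 * r + 2))))"
proof -
  let ?b = "gauss_binomial (2 * n) (n + (3 * r + 2))" and ?m = "3 * r + 2"
  have b: "ev z ?b = 0"
    "z ^ Suc (triangle (3 * r + 1)) * (1 - z ^ ?m) * dv z ?b = - 2 * of_nat n * (- 1) ^ (3 * r + 1)"
    using gauss_binomial_2n_at_root[of "3 * r + 1"] assms by simp_all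
  show "ev z P = 0"
    by (simp add: P_def b(1)[simplified])
  have e: "Suc (6 * r\<^sup>2 + 9 * r + 3) = 3 * triangle r + ?m + Suc (triangle (3 * r + 1))"
  proof -
    have "2 * Suc (6 * r\<^sup>2 + 9 * r + 3) = 3 * (2 * triangle r) + 2 * ?m + 2 + 2 * triangle (3 * r + 1)"
      unfolding double_triangle by (simp add: power2_eq_square algebra_simps)
    then show ?thesis by simp
  qed
  have nz: "1 - z ^ ?m \<noteq> 0"
    using power_neq_1[of ?m] assms by simp
  have "z * dv z P = z ^ Suc (6 * r\<^sup>2 + 9 * r + 3) * dv z ?b"
    unfolding P_def dv_mult b(1) by (simp only: ev_power ev_qvar power_Suc mult_ac mult_zero_left add_0_right)
  also have "\<dots> * (1 - z ^ ?m)
      = z ^ (3 * triangle r) * z ^ ?m * (z ^ Suc (triangle (3 * r + 1)) * (1 - z ^ ?m) * dv z ?b)"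
    unfolding e by (simp only: power_add mult_ac)
  also have "\<dots> = 2 * of_nat n * ((- 1) ^ r * z ^ (3 * triangle r) * z ^ ?m)"
    unfolding b(2) by (simp add: power_mult)
  finally have "z * dv z P = 2 * of_nat n * ((- 1) ^ r * z ^ (3 * triangle r) * z ^ ?m) / (1 - z ^ ?m)"
    by (rule iffD2[OF nonzero_eq_divide_eq[OF nz]])
  then show "z * dv z P = 2 * of_nat n * ((- 1) ^ r * z ^ (3 * triangle r) * (z ^ ?m / (1 - z ^ ?m)))"
    by (simp only: times_divide_eq_right)
qed

lemma tauraso_term_at_root:
  assumes "3 * r + 2 < n"
  shows "ev z (tauraso_term n r) = 0"
    and "z * dv z (tauraso_term n r) = - 2 * of_nat n * ((- 1) ^ r * z ^ (3 * triangle r)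
      * (1 / (1 - z ^ (3 * r + 1)) + z ^ (3 * r + 2) / (1 - z ^ (3 * r + 2))))"
proof -
  have "3 * r + 1 < n" using assms by simp
  note first = tauraso_first_at_root[OF this] and second = tauraso_second_at_root[OF assms]
  show "ev z (tauraso_term n r) = 0"
    by (simp only: tauraso_term_def ev_diff first second diff_self)
  have "- 2 * of_nat n * x - 2 * of_nat n * y = - 2 * of_nat n * (x + y)" for x y :: complex
    by (simp add: distrib_left)
  then show "z * dv z (tauraso_term n r) = - 2 * of_nat n * ((- 1) ^ r * z ^ (3 * triangle r)
      * (1 / (1 - z ^ (3 * r + 1)) + z ^ (3 * r + 2) / (1 - z ^ (3 * r + 2))))"
    by (simp only: tauraso_term_def dv_diff right_diff_distrib first(2) second(2)
        distrib_left[of "(- 1) ^ r * z ^ (3 * triangle r)"])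
qed

text \<open>For \<open>i + j \<ge> n\<close> the squared coefficient has a double zero at
  \<open>z\<close>. The remaining terms are grouped by \<open>k = i + j\<close>, where q-Vandermonde
  and Tauraso's identity apply.\<close>

lemma truncated_sum_at_root:
  defines "S \<equiv> \<Sum>i = 0..n - 1. \<Sum>j = 0..n - 1. qvar ^ (j\<^sup>2 + i + j) * (gauss_binomial (i + j) i)\<^sup>2"
  assumes "n \<le> 3 * R"
  shows "ev z S = (\<Sum>r<R. ev z (tauraso_term n r))"
    and "dv z S = (\<Sum>r<R. dv z (tauraso_term n r))"
proof -
  let ?f = "\<lambda>i j. qvar ^ (j\<^sup>2 + i + j) * (gauss_binomial (i + j) i)\<^sup>2"
  let ?A = "SIGMA i:{..<n}. {..<n}"
  let ?B = "{(i, j). i + j < n}"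
  have "{0..n - 1} = {..<n}"
    using period_pos by auto
  then have "S = (\<Sum>(i, j)\<in>?A. ?f i j)"
    by (simp add: S_def sum.cartesian_product)
  also have "?A = ?B \<union> (?A - ?B)"
    by auto
  also have "(\<Sum>(i, j)\<in>?B \<union> (?A - ?B). ?f i j) = (\<Sum>(i, j)\<in>?B. ?f i j) + (\<Sum>(i, j)\<in>?A - ?B. ?f i j)"
  proof (rule sum.union_disjoint)
    have "?B \<subseteq> ?A" by auto
    then show "finite ?B" by (rule finite_subset) simp
  qed auto
  also have "(\<Sum>(i, j)\<in>?B. ?f i j) = (\<Sum>k<n. \<Sum>i\<le>k. ?f i (k - i))"
    by (rule sum.triangle_reindex)
  also have "\<dots> = (\<Sum>r<R. tauraso_term n r)"
    unfolding sum_central_gauss_binomial[OF assms(2), symmetric]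
  proof (rule sum.cong[OF refl])
    fix k
    have "(\<Sum>i\<le>k. ?f i (k - i)) = (\<Sum>j\<le>k. ?f (k - j) j)"
      by (rule sum.reindex_bij_witness[of _ "\<lambda>j. k - j" "\<lambda>i. k - i"]) auto
    also have "\<dots> = (\<Sum>j\<le>k. qvar ^ k * (qvar ^ j\<^sup>2 * (gauss_binomial k j)\<^sup>2))"
    proof (rule sum.cong[OF refl])
      fix j assume "j \<in> {..k}"
      then have "j\<^sup>2 + (k - j) + j = k + j\<^sup>2" "k - j + j = k" "j \<le> k" by simp_all
      then show "?f (k - j) j = qvar ^ k * (qvar ^ j\<^sup>2 * (gauss_binomial k j)\<^sup>2)"
        by (simp only: gauss_binomial_symmetric power_add mult.assoc)
    qed
    also have "\<dots> = qvar ^ k * gauss_binomial (2 * k) k"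
      by (simp only: sum_distrib_left[symmetric] q_Vandermonde_central)
    finally show "(\<Sum>i\<le>k. ?f i (k - i)) = qvar ^ k * gauss_binomial (2 * k) k" .
  qed
  finally have S: "S = (\<Sum>r<R. tauraso_term n r) + (\<Sum>(i, j)\<in>?A - ?B. ?f i j)" .
  have zero: "ev z (?f i j) = 0 \<and> dv z (?f i j) = 0" if "(i, j) \<in> ?A - ?B" for i j
    using ev_gauss_binomial_eq_0[of i j] that by (auto simp: dv_mult power2_eq_square)
  have "ev z (\<Sum>(i, j)\<in>?A - ?B. ?f i j) = 0" "dv z (\<Sum>(i, j)\<in>?A - ?B. ?f i j) = 0"
    unfolding ev_sum dv_sum by (rule sum.neutral; use zero in fast)+
  then show "ev z S = (\<Sum>r<R. ev z (tauraso_term n r))"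
    and "dv z S = (\<Sum>r<R. dv z (tauraso_term n r))"
    by (simp_all only: S ev_add dv_add ev_sum dv_sum add_0_right)
qed

section \<open>Evaluation of the derivative sums by residue mod 3\<close>

text \<open>For \<open>3 * r + 2 < n\<close>, this is \<open>z * dv z (tauraso_term n r)\<close>
  divided by \<open>- 2 * of_nat n\<close>.\<close>

definition lambert_term :: "nat \<Rightarrow> complex" where
  "lambert_term r = (- 1) ^ r * z ^ (3 * triangle r)
     * (1 / (1 - z ^ (3 * r + 1)) + z ^ (3 * r + 2) / (1 - z ^ (3 * r + 2)))"

lemma cube_power_neq_1:
  assumes "\<not> 3 dvd n" "0 < v" "v < n"
  shows "(z ^ 3) ^ v \<noteq> 1"
proof -
  have "coprime 3 n"
    using assms(1) by (intro prime_imp_coprime) simp_all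
  then have "coprime n 3"
    by (simp only: coprime_commute)
  then show ?thesis
    using assms(2,3) by (auto simp: power_mult[symmetric] power_eq_1_iff coprime_dvd_mult_right_iff
        dest: dvd_imp_le)
qed

lemma cube_inverse: "z ^ 3 * inverse (z ^ 3) = 1"
  using z_nonzero by simp

lemma inverse_pair:
  fixes x y :: complex
  assumes "x * y = 1" "y \<noteq> 1"
  shows "1 / (1 - x) = - (y / (1 - y))" and "x / (1 - x) = - (1 / (1 - y))"
proof -
  have y: "y \<noteq> 0" using assms(1) by auto
  then have x: "x = 1 / y" using assms(1) by (simp add: nonzero_eq_divide_eq)
  show "1 / (1 - x) = - (y / (1 - y))" and "x / (1 - x) = - (1 / (1 - y))"
    unfolding x using y assms(2) by (simp_all add: divide_simps) (simp_all add: algebra_simps)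
qed

text \<open>The second part at \<open>t - 1 - r\<close> cancels the first part at \<open>r\<close>:
  the two powers of \<open>z\<close> are mutually inverse and the weights agree.\<close>

lemma lambert_sum_mod_0:
  assumes n: "n = 3 * t"
  shows "(\<Sum>r<t. lambert_term r) = 0"
proof -
  let ?c = "\<lambda>r. (- 1) ^ r * z ^ (3 * triangle r)"
  let ?f = "\<lambda>r. ?c r * (1 / (1 - z ^ (3 * r + 1)))"
  let ?g = "\<lambda>r. ?c r * (z ^ (3 * r + 2) / (1 - z ^ (3 * r + 2)))"
  have g: "?g (t - Suc r) = - ?f r" if "r < t" for r
  proof -
    define s where "s = t - Suc r"
    have t: "t = Suc (s + r)" using that by (simp add: s_def)
    have "2 * (3 * triangle s + n * r) = 2 * (3 * triangle r) + n * (s + r)"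
    proof -
      have "3 * (2 * triangle s) + 2 * (n * r) = 3 * (2 * triangle r) + n * (s + r)"
        unfolding double_triangle n t by (simp add: algebra_simps)
      then show ?thesis by simp
    qed
    then have "z ^ (3 * triangle s + n * r) = (- 1) ^ (s + r) * z ^ (3 * triangle r)"
      by (rule half_period_shift)
    then have c: "?c s = ?c r"
      by (simp add: power_add power_mult_n mult.assoc[symmetric] flip: power_mult_distrib)
    have "3 * s + 2 + (3 * r + 1) = n" by (simp add: n t)
    then have "z ^ (3 * s + 2) * z ^ (3 * r + 1) = 1"
      by (simp only: power_add[symmetric] power_period)
    moreover have "z ^ (3 * r + 1) \<noteq> 1"
      using that by (intro power_neq_1) (simp_all add: n)
    ultimately have "z ^ (3 * s + 2) / (1 - z ^ (3 * s + 2)) = - (1 / (1 - z ^ (3 * r + 1)))"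
      by (rule inverse_pair(2))
    then show ?thesis
      by (simp only: c mult_minus_right flip: s_def)
  qed
  have "(\<Sum>r<t. lambert_term r) = sum ?f {..<t} + sum ?g {..<t}"
    by (simp only: lambert_term_def distrib_left sum.distrib)
  also have "sum ?g {..<t} = (\<Sum>r<t. ?g (t - Suc r))"
    by (rule sum.nat_diff_reindex[symmetric])
  also have "\<dots> = - sum ?f {..<t}"
    unfolding sum_negf[symmetric] by (intro sum.cong refl g) simp
  finally show ?thesis by simp
qed

text \<open>With \<open>p = z ^ 3\<close>, the power \<open>z ^ (3 * r + 1)\<close> is inverse to
  \<open>p ^ (t - r)\<close>, and \<open>z ^ (3 * r + 2)\<close> equals
  \<open>p ^ (t + 1 + r)\<close>. The sum is thus a theta-Lambert sum, whose evaluation leaves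
  \<open>t\<close> reciprocals with mean 1/2.\<close>

lemma lambert_sum_mod_1:
  assumes n: "n = 3 * t + 1"
  shows "(\<Sum>r<t. lambert_term r) = of_nat t / 2 * z ^ (t * (3 * t + 2))"
proof -
  define p where "p = z ^ 3"
  define w where "w = inverse p"
  have pw: "p * w = 1" unfolding w_def p_def by (rule cube_inverse)
  have "\<not> 3 dvd n" unfolding n by presburger
  then have ne: "p ^ v \<noteq> 1" if "0 < v" "v \<le> 2 * t" for v
    unfolding p_def using that by (intro cube_power_neq_1) (auto simp: n)
  let ?f = "\<lambda>v. theta_term p w t v / (1 - p ^ v)" and ?c = "(- 1) ^ t * p ^ triangle t"
  have split: "lambert_term r = - ?c * (?f (t - r) + ?f (t + 1 + r))" if "r < t" for r
  proof -
    define v where "v = t - r"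
    have t: "t = r + v" using that by (simp add: v_def)
    have 1: "?c * theta_term p w t v = (- 1) ^ r * p ^ triangle r * p ^ v"
      unfolding t by (rule theta_term_complement(1)[OF pw])
    have 2: "?c * theta_term p w t (t + 1 + r) = - ((- 1) ^ r * p ^ triangle r * p ^ (t + 1 + r))"
      by (rule theta_term_complement(2)[OF pw])
    have "3 * r + 1 + 3 * v = n" by (simp add: n t)
    then have "z ^ (3 * r + 1) * p ^ v = z ^ n"
      by (simp only: p_def power_mult[symmetric] power_add[symmetric])
    then have A: "1 / (1 - z ^ (3 * r + 1)) = - (p ^ v / (1 - p ^ v))"
      using ne[of v] that by (intro inverse_pair(1)) (simp_all add: power_period v_def)
    have "3 * (t + 1 + r) = n + (3 * r + 2)" by (simp add: n)
    then have "p ^ (t + 1 + r) = z ^ (n + (3 * r + 2))"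
      by (simp only: p_def power_mult[symmetric])
    then have B: "z ^ (3 * r + 2) = p ^ (t + 1 + r)"
      by (simp only: power_add power_period mult_1_left)
    have "- ?c * (?f v + ?f (t + 1 + r))
        = - (?c * theta_term p w t v / (1 - p ^ v)
           + ?c * theta_term p w t (t + 1 + r) / (1 - p ^ (t + 1 + r)))"
      by (simp only: distrib_left mult_minus_left times_divide_eq_right minus_add_distrib
          minus_divide_left)
    also have "\<dots> = lambert_term r"
      unfolding 1 2 lambert_term_def A B p_def[symmetric] power_mult
      by (simp only: distrib_left mult_minus_right times_divide_eq_right minus_add_distrib
          minus_divide_left minus_minus mult_1_right)
    finally show ?thesis by (simp only: v_def)
  qed
  have "(\<Sum>r<t. lambert_term r) = - ?c * (\<Sum>v = 1..2 * t. ?f v)"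
    unfolding sum_split_middle sum_distrib_left by (intro sum.cong refl split) simp
  also have "(\<Sum>v = 1..2 * t. ?f v) = - (\<Sum>i = t + 1..2 * t. 1 / (1 - p ^ i))"
    by (rule theta_lambert_even[OF pw ne])
  also have "(\<Sum>i = t + 1..2 * t. 1 / (1 - p ^ i)) = of_nat (Suc (2 * t) - (t + 1)) / 2"
  proof (rule sum_inverse_one_minus)
    \<comment> \<open>The two ends of the range add up to \<open>n\<close>, as the pairing
      requires.\<close>
    have "t + 1 + 2 * t = n" by (simp add: n)
    then show "p ^ (t + 1 + 2 * t) = 1"
      by (simp add: p_def power_period flip: power_mult) (simp add: power_period power_mult mult.commute[of 3])
  qed (use ne in auto)
  also have "- ?c * (- (of_nat (Suc (2 * t) - (t + 1)) / 2)) = of_nat t / 2 * ?c"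
    by simp
  also have "?c = z ^ (t * (3 * t + 2))"
  proof -
    have "2 * (t * (3 * t + 2)) = 3 * (2 * triangle t) + n * t"
      unfolding double_triangle n by (simp add: algebra_simps)
    then have "z ^ (t * (3 * t + 2)) = (- 1) ^ t * z ^ (3 * triangle t)"
      by (intro half_period_shift) simp
    then show ?thesis by (simp add: p_def power_mult)
  qed
  finally show ?thesis .
qed

text \<open>Compared with residue 1 the two powers exchange roles: \<open>z ^ (3 * r + 1)\<close> is
  now a power of \<open>p\<close> and \<open>z ^ (3 * r + 2)\<close> the inverse of one. The extra
  term is the unpaired summand \<open>v = 2 * s + 1\<close>, hence the odd evaluation; it comes from
  the offset \<open>3 * s + 1 = n - 1\<close>.\<close>

lemma lambert_sum_mod_2:
  assumes n: "n = 3 * s + 2"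
  shows "(\<Sum>r<s. lambert_term r) + (- 1) ^ s * z ^ (3 * triangle s) * (1 / (1 - z ^ (3 * s + 1)))
    = - (of_nat (s + 1) / 2 * z ^ ((3 * s + 1) * (s + 1)))"
proof -
  define p where "p = z ^ 3"
  define w where "w = inverse p"
  have pw: "p * w = 1" unfolding w_def p_def by (rule cube_inverse)
  have "\<not> 3 dvd n" unfolding n by presburger
  then have ne: "p ^ v \<noteq> 1" if "0 < v" "v \<le> 2 * s + 1" for v
    unfolding p_def using that by (intro cube_power_neq_1) (auto simp: n)
  let ?f = "\<lambda>v. theta_term p w (Suc s) v / (1 - p ^ v)" and ?c = "(- 1) ^ s * p ^ triangle s"
  have first: "- ?c * ?f (s + 1 + r) = (- 1) ^ r * z ^ (3 * triangle r) * (1 / (1 - z ^ (3 * r + 1)))" for r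
  proof -
    have "3 * (s + 1 + r) = n + (3 * r + 1)" by (simp add: n)
    then have "p ^ (s + 1 + r) = z ^ (n + (3 * r + 1))"
      by (simp only: p_def power_mult[symmetric])
    then have B: "z ^ (3 * r + 1) = p ^ (s + 1 + r)"
      by (simp only: power_add power_period mult_1_left)
    have "- ?c * ?f (s + 1 + r) = - (?c * theta_term p w (Suc s) (s + 1 + r)) / (1 - p ^ (s + 1 + r))"
      by (simp only: mult_minus_left times_divide_eq_right minus_divide_left)
    also have "\<dots> = (- 1) ^ r * p ^ triangle r / (1 - p ^ (s + 1 + r))"
      unfolding theta_term_complement(4)[OF pw] minus_minus ..
    finally show ?thesis
      by (simp only: B power_mult p_def[symmetric] times_divide_eq_right mult_1_right)
  qed
  have split: "lambert_term r = - ?c * (?f (s - r) + ?f (s + 1 + r))" if "r < s" for r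
  proof -
    define v where "v = s - r"
    have s: "s = r + v" using that by (simp add: v_def)
    have 1: "?c * theta_term p w (Suc s) v = (- 1) ^ r * p ^ triangle r"
      unfolding s by (rule theta_term_complement(3)[OF pw])
    have "3 * r + 2 + 3 * v = n" by (simp add: n s)
    then have "z ^ (3 * r + 2) * p ^ v = z ^ n"
      by (simp only: p_def power_mult[symmetric] power_add[symmetric])
    then have A: "z ^ (3 * r + 2) / (1 - z ^ (3 * r + 2)) = - (1 / (1 - p ^ v))"
      using ne[of v] that by (intro inverse_pair(2)) (simp_all add: power_period v_def)
    have "- ?c * ?f v = - (?c * theta_term p w (Suc s) v) / (1 - p ^ v)"
      by (simp only: mult_minus_left times_divide_eq_right minus_divide_left)
    also have "\<dots> = (- 1) ^ r * z ^ (3 * triangle r) * (z ^ (3 * r + 2) / (1 - z ^ (3 * r + 2)))"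
      unfolding 1 A power_mult p_def[symmetric]
      by (simp only: mult_minus_right times_divide_eq_right mult_1_right minus_divide_left)
    finally show ?thesis
      by (simp only: v_def distrib_left first lambert_term_def) (rule add.commute)
  qed
  have "(\<Sum>r<s. lambert_term r) = - ?c * (\<Sum>v = 1..2 * s. ?f v)"
    unfolding sum_split_middle sum_distrib_left by (intro sum.cong refl split) simp
  then have "(\<Sum>r<s. lambert_term r) + (- 1) ^ s * z ^ (3 * triangle s) * (1 / (1 - z ^ (3 * s + 1)))
      = - ?c * (\<Sum>v = 1..2 * s. ?f v) + - ?c * ?f (s + 1 + s)"
    by (simp only: first)
  also have "\<dots> = - ?c * (\<Sum>v = 1..2 * s + 1. ?f v)"
    unfolding distrib_left[symmetric] by (simp add: mult_2)
  also have "(\<Sum>v = 1..2 * s + 1. ?f v) = - (\<Sum>i = s + 1..2 * s + 1. 1 / (1 - p ^ i))"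
    by (rule theta_lambert_odd[OF pw ne]) simp_all
  also have "(\<Sum>i = s + 1..2 * s + 1. 1 / (1 - p ^ i)) = of_nat (Suc (2 * s + 1) - (s + 1)) / 2"
  proof (rule sum_inverse_one_minus)
    have "s + 1 + (2 * s + 1) = n" by (simp add: n)
    then show "p ^ (s + 1 + (2 * s + 1)) = 1"
      by (simp add: p_def power_period flip: power_mult) (simp add: power_period power_mult mult.commute[of 3])
  qed (use ne in auto)
  also have "- ?c * (- (of_nat (Suc (2 * s + 1) - (s + 1)) / 2)) = of_nat (s + 1) / 2 * ?c"
    by (simp add: Suc_diff_le)
  also have "?c = - (z ^ ((3 * s + 1) * (s + 1)))"
  proof -
    have "2 * ((3 * s + 1) * (s + 1)) = 3 * (2 * triangle s) + n * (s + 1)"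
      unfolding double_triangle n by (simp add: algebra_simps)
    then have "z ^ ((3 * s + 1) * (s + 1)) = (- 1) ^ (s + 1) * z ^ (3 * triangle s)"
      by (intro half_period_shift) simp
    then show ?thesis by (simp add: p_def power_mult)
  qed
  finally show ?thesis by simp
qed

text \<open>The offset equal to \<open>n\<close> supplies the value at \<open>z\<close>. Its
  exponent exceeds \<open>(n\<^sup>2 - 1) div 3\<close> by a multiple of \<open>n\<close>, and the
  resulting excess in the derivative is cancelled by the Lambert sum.\<close>

lemma congruence_at_root:
  defines "S \<equiv> \<Sum>i = 0..n - 1. \<Sum>j = 0..n - 1. qvar ^ (j\<^sup>2 + i + j) * (gauss_binomial (i + j) i)\<^sup>2"
  defines "P \<equiv> S - of_int (Legendre (int n) 3) * qvar ^ ((n\<^sup>2 - 1) div 3)"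
  shows "ev z P = 0 \<and> dv z P = 0"
proof -
  have lambert: "z * dv z (tauraso_term n r) = - 2 * of_nat n * lambert_term r" if "3 * r + 2 < n" for r
    unfolding lambert_term_def by (rule tauraso_term_at_root(2)[OF that])
  have sum_ev: "(\<Sum>r<t. ev z (tauraso_term n r)) = 0" if "3 * t \<le> n" for t
    using that by (intro sum.neutral ballI tauraso_term_at_root(1)) simp
  have sum_dv: "z * (\<Sum>r<t. dv z (tauraso_term n r)) = - 2 * of_nat n * (\<Sum>r<t. lambert_term r)"
    if "3 * t \<le> n" for t
    unfolding sum_distrib_left by (intro sum.cong refl lambert) (use that in simp)
  have "ev z P = 0 \<and> z * dv z P = 0"
  proof -
    consider t where "n = 3 * t" | t where "n = 3 * t + 1" | s where "n = 3 * s + 2"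
    proof -
      have "n = 3 * (n div 3) \<or> n = 3 * (n div 3) + 1 \<or> n = 3 * (n div 3) + 2" by presburger
      then show thesis using that by blast
    qed
    then show ?thesis
    proof cases
      \<comment> \<open>No offset prime to 3 equals \<open>n\<close> here, so every term vanishes at
        \<open>z\<close>.\<close>
      case (1 t)
      then have "Legendre (int n) 3 = 0" by (simp add: Legendre_3)
      then have "P = S" by (simp add: P_def)
      then show ?thesis
        using truncated_sum_at_root[of t] sum_ev[of t] sum_dv[of t] lambert_sum_mod_0[OF 1]
        by (simp add: S_def 1)
    next
      case (2 t)
      let ?B = "t * (3 * t + 2)"
      have "(int n) mod 3 = 1" unfolding 2 by simp
      then have L: "Legendre (int n) 3 = 1" by (simp add: Legendre_3)
      have "(n\<^sup>2 - 1) div 3 = ?B"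
        unfolding 2 by (simp add: power2_eq_square algebra_simps)
      then have P: "P = S - qvar ^ ?B" by (simp add: P_def L)
      have e: "6 * t\<^sup>2 + 3 * t = n * t + ?B"
        unfolding 2 by (simp add: power2_eq_square algebra_simps)
      have "2 * n = n + (3 * t + 1)" "2 * n < n + (3 * t + 2)"
        by (simp_all add: 2)
      \<comment> \<open>In the boundary term the first coefficient is the end of its row, hence 1,
        and the second lies beyond it, hence 0.\<close>
      then have last: "tauraso_term n t = qvar ^ (n * t + ?B)"
        unfolding tauraso_term_def e
        by (simp only: gauss_binomial_self gauss_binomial_eq_0 mult_1_right mult_zero_right diff_0_right)
      have R: "n \<le> 3 * Suc t" "3 * t \<le> n" by (simp_all add: 2)
      have "ev z S = z ^ ?B"
        unfolding S_def truncated_sum_at_root(1)[OF R(1)]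
        by (simp only: sum.lessThan_Suc sum_ev[OF R(2)] last ev_power ev_qvar)
          (simp only: power_add power_mult_n, simp)
      moreover have "z * dv z S = - 2 * of_nat n * (\<Sum>r<t. lambert_term r) + of_nat (n * t + ?B) * z ^ ?B"
        unfolding S_def truncated_sum_at_root(2)[OF R(1)]
        by (simp only: sum.lessThan_Suc distrib_left sum_dv[OF R(2)] last dv_qvar_power)
          (simp only: power_add power_mult_n mult_1_left)
      ultimately show ?thesis
        unfolding P lambert_sum_mod_1[OF 2]
        by (simp only: ev_diff dv_diff ev_power ev_qvar right_diff_distrib dv_qvar_power of_nat_add
            of_nat_mult) (simp add: algebra_simps)
    next
      case (3 s)
      let ?B = "(3 * s + 1) * (s + 1)"
      let ?b = "gauss_binomial (2 * n) (n + (3 * s + 1))"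
      have "(int n) mod 3 = 2" unfolding 3 by simp
      then have L: "Legendre (int n) 3 = - 1" by (simp add: Legendre_3)
      have "(n\<^sup>2 - 1) div 3 = ?B"
        unfolding 3 by (simp add: power2_eq_square algebra_simps)
      then have P: "P = S + qvar ^ ?B" by (simp add: P_def L)
      have e: "6 * s\<^sup>2 + 9 * s + 3 = n * (s + 1) + ?B"
        unfolding 3 by (simp add: power2_eq_square algebra_simps)
      have "gauss_binomial (2 * n) (n + (3 * s + 2)) = 1"
        using gauss_binomial_self[of "2 * n"] by (simp add: 3 mult_2)
      \<comment> \<open>Here the second coefficient ends its row, while the first still vanishes at
        \<open>z\<close> and contributes the extra Lambert term.\<close>
      then have last: "tauraso_term n s = qvar ^ (6 * s\<^sup>2 + 3 * s) * ?b - qvar ^ (n * (s + 1) + ?B)"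
        unfolding tauraso_term_def e by (simp only: mult_1_right)
      have R: "n \<le> 3 * Suc s" "3 * s \<le> n" "3 * s + 1 < n" by (simp_all add: 3)
      note first = tauraso_first_at_root[OF R(3)]
      have "ev z S = - (z ^ ?B)"
        unfolding S_def truncated_sum_at_root(1)[OF R(1)]
        by (simp only: sum.lessThan_Suc sum_ev[OF R(2)] last ev_diff first(1) ev_power ev_qvar)
          (simp only: power_add power_mult_n, simp)
      moreover have "z * dv z S = - 2 * of_nat n * ((\<Sum>r<s. lambert_term r)
          + (- 1) ^ s * z ^ (3 * triangle s) * (1 / (1 - z ^ (3 * s + 1))))
          - of_nat (n * (s + 1) + ?B) * z ^ ?B"
        unfolding S_def truncated_sum_at_root(2)[OF R(1)]
        by (simp only: sum.lessThan_Suc distrib_left right_diff_distrib sum_dv[OF R(2)] last dv_diff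
            first(2) dv_qvar_power) (simp only: power_add power_mult_n mult_1_left add_diff_eq)
      moreover have "- 2 * of_nat n * - (of_nat (s + 1) / 2 * z ^ ?B) = of_nat n * of_nat (s + 1) * z ^ ?B"
        by simp
      ultimately show ?thesis
        unfolding P lambert_sum_mod_2[OF 3]
        by (simp only: ev_add dv_add ev_power ev_qvar distrib_left dv_qvar_power of_nat_add
            of_nat_mult) (simp add: algebra_simps)
    qed
  qed
  then show ?thesis using z_nonzero by simp
qed

end

theorem theorem1p3:
  fixes n :: nat
  assumes "n > 0"
  shows "(cyclotomic n)\<^sup>2 dvd
    (\<Sum>i = 0..n - 1. \<Sum>j = 0..n - 1. qvar ^ (j\<^sup>2 + i + j) * (gauss_binomial (i + j) i)\<^sup>2)
      - of_int (Legendre (int n) 3) * qvar ^ ((n\<^sup>2 - 1) div 3)"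
  by (rule cyclotomic_squared_dvd[OF assms], rule congruence_at_root)

end
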